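(* Let $L$ be a minimal aperiodic shift with linear complexity, and let $\mu$ be a $\sigma$-invariant Borel probability measure on $L$. Then $(L,\sigma)$ is topologically conjugate to $(\hat I,\hat T)$ via the homeomorphism $\phi$, $\hat T$ extends $T_L|_I$, and $T_L|_I$ is an almost finite interval exchange transformation.
   Context: Words, shifts and orders. Let $A$ be a finite alphabet with a total order, extended lexicographically to $A^{\mathbb N}$, which carries the Cantor (product) topology. The shift map is $\sigma(a_0a_1\dots)=a_1a_2\dots$. A shift is a closed $L\subseteq A^{\mathbb N}$ with $\sigma(L)\subseteq L$. $Fact_L(n)$ is the set of length-$n$ factors of words of $L$ and $p_L(n)=|Fact_L(n)|$. $L$ has linear complexity if $p_L(n)=O(n)$. $L$ is minimal if it has no nonempty proper closed $\sigma$-invariant subset, and aperiodic if it is not the orbit of one periodic word. For $w\le w'$ in $L$, $[w,w']=\{w''\in L:w\le w''\le w'\}$, and $w_{L,min}$ denotes the smallest word of $L$. Construction. Put $\phi_\mu(w)=\mu([w_{L,min},w])$. Let $Z_0$ be the set of $x\in[0,1]$ with $|\phi_\mu^{-1}(x)|\ge 2$; each such preimage consists of exactly two consecutive words. Let $\hat I=[0,1]\sqcup Z_0^-$, where $Z_0^-=\{z^-:z\in Z_0\}$ is a disjoint copy of $Z_0$. Order $\hat I$ so that $z^-<z$ with nothing in between, extending the order of $[0,1]$, and give it the order topology. Let $\iota$ be the inclusion $[0,1]\to\hat I$, and let $\kappa:\hat I\to[0,1]$ be the identity on $[0,1]$ with $z^-\mapsto z$. Define $\phi(w)=(\phi_\mu(w))^-$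 if $\phi_\mu^{-1}(\phi_\mu(w))=\{w,w'\}$ with $w<w'$, and $\phi(w)=\phi_\mu(w)$ otherwise. Set $\hat T=\phi\sigma\phi^{-1}$ and $T_L=\kappa\circ\hat T\circ\iota$, with $I=[0,1)$. IET (finite or infinite). A finite IET is an injective $T:I\to I$ that is a translation on each interval $[x_i,x_{i+1})$ of a finite partition $0=x_0<\dots<x_m=1$. An infinite IET is a map $T:I\to I$ with an infinite set $Y$ of discontinuities whose closure ${\cal D}$ in $I$ is Lebesgue-null. Letting ${\cal D}_{acc,r}$ be the right-accumulation points of ${\cal D}$, $T$ is required to be injective on $I\setminus{\cal D}_{acc,r}$, right-continuous, and a translation on each right-open interval $[x,x')$ with $x\in{\cal D}$, $x'\in{\cal D}\cup\{1\}$, $[x,x')\cap Y\subseteq\{x\}$. Almost finite. An IET $T$ with discontinuity set ${\cal D}$ (the closure of its discontinuities) is almost finite if: (1) there is a finite partition of $I$ into right-open intervals on each of which $T$ is increasing; (2) the set of accumulation points of ${\cal D}$ is finite; (3) ${\cal D}$ is contained in a union of finitely many full orbits of $T$. Here the full orbit of $x$ is its class under the relation $x'\sim x$ iff $T^{n_1}(x')=T^{n_2}(x)$ for some $n_1,n_2\ge0$. *)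

theory Defs
  imports "HOL-Analysis.Analysis" "HOL-Probability.Probability"
begin

text \<open>Infinite words over a finite totally ordered alphabet 'a, which carries the
discrete topology; nat => 'a then carries the product (Cantor) topology.\<close>

definition shiftmap :: "(nat \<Rightarrow> 'a) \<Rightarrow> (nat \<Rightarrow> 'a)" where
  "shiftmap w = (\<lambda>i. w (Suc i))"

definition lex_less :: "(nat \<Rightarrow> 'a::linorder) \<Rightarrow> (nat \<Rightarrow> 'a) \<Rightarrow> bool" where
  "lex_less w w' \<longleftrightarrow> (\<exists>n. (\<forall>i<n. w i = w' i) \<and> w n < w' n)"

definition lex_le :: "(nat \<Rightarrow> 'a::linorder) \<Rightarrow> (nat \<Rightarrow> 'a) \<Rightarrow> bool" where
  "lex_le w w' \<longleftrightarrow> w = w' \<or> lex_less w w'"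

definition is_shift :: "(nat \<Rightarrow> 'a::topological_space) set \<Rightarrow> bool" where
  "is_shift L \<longleftrightarrow> closed L \<and> shiftmap ` L \<subseteq> L"

definition Fact :: "(nat \<Rightarrow> 'a) set \<Rightarrow> nat \<Rightarrow> 'a list set" where
  "Fact L n = {map (\<lambda>i. w (k + i)) [0..<n] | w k. w \<in> L}"

definition complexity :: "(nat \<Rightarrow> 'a) set \<Rightarrow> nat \<Rightarrow> nat" where
  "complexity L n = card (Fact L n)"

definition linear_complexity :: "(nat \<Rightarrow> 'a) set \<Rightarrow> bool" where
  "linear_complexity L \<longleftrightarrow> (\<lambda>n. real (complexity L n)) \<in> O(\<lambda>n. real n)"

definition minimal_shift :: "(nat \<Rightarrow> 'a::topological_space) set \<Rightarrow> bool" where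
  "minimal_shift L \<longleftrightarrow> L \<noteq> {} \<and>
     (\<forall>K. K \<noteq> {} \<and> K \<subseteq> L \<and> closed K \<and> shiftmap ` K \<subseteq> K \<longrightarrow> K = L)"

definition aperiodic_shift :: "(nat \<Rightarrow> 'a) set \<Rightarrow> bool" where
  "aperiodic_shift L \<longleftrightarrow>
     \<not> (\<exists>w p. p > 0 \<and> (shiftmap ^^ p) w = w \<and> L = {(shiftmap ^^ k) w | k. True})"

definition shift_invariant :: "(nat \<Rightarrow> 'a) measure \<Rightarrow> bool" where
  "shift_invariant \<mu> \<longleftrightarrow> shiftmap \<in> \<mu> \<rightarrow>\<^sub>M \<mu> \<and>
     (\<forall>A\<in>sets \<mu>. emeasure \<mu> (shiftmap -` A \<inter> space \<mu>) = emeasure \<mu> A)"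

definition wmin :: "(nat \<Rightarrow> 'a::linorder) set \<Rightarrow> (nat \<Rightarrow> 'a)" where
  "wmin L = (THE w. w \<in> L \<and> (\<forall>w'\<in>L. lex_le w w'))"

definition lex_interval :: "(nat \<Rightarrow> 'a::linorder) set \<Rightarrow> (nat \<Rightarrow> 'a) \<Rightarrow> (nat \<Rightarrow> 'a) \<Rightarrow> (nat \<Rightarrow> 'a) set" where
  "lex_interval L w w' = {v \<in> L. lex_le w v \<and> lex_le v w'}"

definition phi_mu :: "(nat \<Rightarrow> 'a::linorder) set \<Rightarrow> (nat \<Rightarrow> 'a) measure \<Rightarrow> (nat \<Rightarrow> 'a) \<Rightarrow> real" where
  "phi_mu L \<mu> w = measure \<mu> (lex_interval L (wmin L) w)"

definition Z0 :: "(nat \<Rightarrow> 'a::linorder) set \<Rightarrow> (nat \<Rightarrow> 'a) measure \<Rightarrow> real set" where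
  "Z0 L \<mu> = {x \<in> {0..1}. \<exists>v v'. v \<in> L \<and> v' \<in> L \<and> v \<noteq> v' \<and>
                                   phi_mu L \<mu> v = x \<and> phi_mu L \<mu> v' = x}"

text \<open>\<hat>I = [0,1] disjoint-union Z0^-, represented inside real \<times> bool:
  a point x of [0,1] is (x, True), the extra point z^- is (z, False).\<close>
definition Ihat :: "(nat \<Rightarrow> 'a::linorder) set \<Rightarrow> (nat \<Rightarrow> 'a) measure \<Rightarrow> (real \<times> bool) set" where
  "Ihat L \<mu> = {(x, True) | x. x \<in> {0..1}} \<union> {(z, False) | z. z \<in> Z0 L \<mu>}"

definition ihat_less :: "real \<times> bool \<Rightarrow> real \<times> bool \<Rightarrow> bool" where
  "ihat_less p q \<longleftrightarrow> fst p < fst q \<or> (fst p = fst q \<and> \<not> snd p \<and> snd q)"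

definition ihat_topology :: "(real \<times> bool) set \<Rightarrow> (real \<times> bool) topology" where
  "ihat_topology S = topology_generated_by
     ({{y \<in> S. ihat_less y x} | x. x \<in> S} \<union> {{y \<in> S. ihat_less x y} | x. x \<in> S})"

definition iota :: "real \<Rightarrow> real \<times> bool" where
  "iota x = (x, True)"

definition kappa :: "real \<times> bool \<Rightarrow> real" where
  "kappa p = fst p"

definition phi :: "(nat \<Rightarrow> 'a::linorder) set \<Rightarrow> (nat \<Rightarrow> 'a) measure \<Rightarrow> (nat \<Rightarrow> 'a) \<Rightarrow> real \<times> bool" where
  "phi L \<mu> w =
     (if \<exists>w'. w' \<in> L \<and> lex_less w w' \<and> {v \<in> L. phi_mu L \<mu> v = phi_mu L \<mu> w} = {w, w'}
      then (phi_mu L \<mu> w, False) else (phi_mu L \<mu> w, True))"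

definition That :: "(nat \<Rightarrow> 'a::linorder) set \<Rightarrow> (nat \<Rightarrow> 'a) measure \<Rightarrow> real \<times> bool \<Rightarrow> real \<times> bool" where
  "That L \<mu> p = phi L \<mu> (shiftmap (inv_into L (phi L \<mu>) p))"

definition T_L :: "(nat \<Rightarrow> 'a::linorder) set \<Rightarrow> (nat \<Rightarrow> 'a) measure \<Rightarrow> real \<Rightarrow> real" where
  "T_L L \<mu> = kappa \<circ> That L \<mu> \<circ> iota"

abbreviation I01 :: "real set" where
  "I01 \<equiv> {0..<1}"

definition finite_IET :: "(real \<Rightarrow> real) \<Rightarrow> bool" where
  "finite_IET T \<longleftrightarrow> (\<forall>x\<in>I01. T x \<in> I01) \<and> inj_on T I01 \<and>
     (\<exists>(xs::nat \<Rightarrow> real) m. xs 0 = 0 \<and> xs m = 1 \<and> (\<forall>i<m. xs i < xs (Suc i)) \<and>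
        (\<forall>i<m. \<exists>c. \<forall>t\<in>{xs i..<xs (Suc i)}. T t = t + c))"

definition discont :: "(real \<Rightarrow> real) \<Rightarrow> real set" where
  "discont T = {x \<in> I01. \<not> continuous (at x within I01) T}"

definition Dset :: "(real \<Rightarrow> real) \<Rightarrow> real set" where
  "Dset T = closure (discont T) \<inter> I01"

definition D_acc_r :: "(real \<Rightarrow> real) \<Rightarrow> real set" where
  "D_acc_r T = {x \<in> I01. x islimpt (Dset T \<inter> {x<..})}"

definition infinite_IET :: "(real \<Rightarrow> real) \<Rightarrow> bool" where
  "infinite_IET T \<longleftrightarrow> (\<forall>x\<in>I01. T x \<in> I01) \<and>
     infinite (discont T) \<and> Dset T \<in> null_sets lborel \<and>
     inj_on T (I01 - D_acc_r T) \<and>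
     (\<forall>x\<in>I01. continuous (at x within {x..<1}) T) \<and>
     (\<forall>x x'. x \<in> Dset T \<and> x' \<in> Dset T \<union> {1} \<and> x < x' \<and> {x..<x'} \<inter> discont T \<subseteq> {x}
        \<longrightarrow> (\<exists>c. \<forall>t\<in>{x..<x'}. T t = t + c))"

definition IET :: "(real \<Rightarrow> real) \<Rightarrow> bool" where
  "IET T \<longleftrightarrow> finite_IET T \<or> infinite_IET T"

definition full_orbit :: "(real \<Rightarrow> real) \<Rightarrow> real \<Rightarrow> real set" where
  "full_orbit T x = {x' \<in> I01. \<exists>n1 n2. (T ^^ n1) x' = (T ^^ n2) x}"

definition almost_finite_IET :: "(real \<Rightarrow> real) \<Rightarrow> bool" where
  "almost_finite_IET T \<longleftrightarrow> IET T \<and>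
     (\<exists>(xs::nat \<Rightarrow> real) m. xs 0 = 0 \<and> xs m = 1 \<and> (\<forall>i<m. xs i < xs (Suc i)) \<and>
        (\<forall>i<m. strict_mono_on {xs i..<xs (Suc i)} T)) \<and>
     finite {x. x islimpt Dset T} \<and>
     (\<exists>F. finite F \<and> F \<subseteq> I01 \<and> Dset T \<subseteq> (\<Union>x\<in>F. full_orbit T x))"

end

theory Submission
  imports Defs
begin

text \<open>
  Aperiodicity makes \<open>\<mu>\<close> atomless and minimality gives it full support, so \<open>\<phi>\<^sub>\<mu>\<close> identifies exactly
  the pairs of consecutive words of \<open>L\<close>; hence \<open>\<phi>\<close> is an order isomorphism between compact Hausdorff
  order topologies. The map \<open>T\<close> sends \<open>x\<close> to the value of the shift of the largest word with value \<open>x\<close>.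
  It jumps at \<open>x\<close> only if the two words over \<open>x\<close> start with different letters, or are \<open>a u\<close> and \<open>a v\<close>
  with some word of \<open>L\<close> strictly between \<open>u\<close> and \<open>v\<close>; away from such gaps, invariance of \<open>\<mu>\<close> makes \<open>T\<close>
  a translation up to words with two left extensions.

  Linear complexity enters only through \<open>p(n+1) - p(n) \<le> C\<close> for infinitely many \<open>n\<close>. First, it bounds
  the number of infinite left special words \<open>s\<close>, and every accumulation point of the discontinuities is
  the value of some \<open>a s\<close>. Second, call the first index where two consecutive words differ the level of
  the pair: there are at most \<open>p(n+1) - p(n)\<close> pairs of level \<open>n\<close>. A pair has an infinite backward
  orbit of pairs (unless that orbit meets the point 0) along which the level grows by at most 1 per step;
  by aperiodicity the points are distinct, so the level tends to infinity and takes every value from the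
  initial one on. So at most \<open>C + 1\<close> full orbits contain all the pairs.
\<close>

subsection \<open>Infinite words in the lexicographic order\<close>

definition agree :: "nat \<Rightarrow> (nat \<Rightarrow> 'a) \<Rightarrow> (nat \<Rightarrow> 'a) \<Rightarrow> bool" where
  "agree n v w \<longleftrightarrow> (\<forall>i<n. v i = w i)"

definition wcons :: "'a \<Rightarrow> (nat \<Rightarrow> 'a) \<Rightarrow> (nat \<Rightarrow> 'a)" where
  "wcons a w = case_nat a w"

lemma agree_0 [simp]: "agree 0 v w"
  by (simp add: agree_def)

lemma agree_refl [simp]: "agree n w w"
  by (simp add: agree_def)

lemma agree_sym: "agree n v w \<Longrightarrow> agree n w v"
  by (simp add: agree_def)

lemma agree_trans: "agree n u v \<Longrightarrow> agree n v w \<Longrightarrow> agree n u w"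
  by (simp add: agree_def)

lemma agree_mono: "agree n v w \<Longrightarrow> m \<le> n \<Longrightarrow> agree m v w"
  by (simp add: agree_def)

lemma agree_Suc: "agree (Suc n) v w \<longleftrightarrow> agree n v w \<and> v n = w n"
  by (auto simp: agree_def less_Suc_eq)

lemma agree_all_imp_eq: "(\<And>n. agree n v w) \<Longrightarrow> v = w"
  by (meson agree_def ext lessI)

lemma agree_shiftmap: "agree (Suc n) v w \<Longrightarrow> agree n (shiftmap v) (shiftmap w)"
  by (simp add: agree_def shiftmap_def)

lemma agree_Suc_iff_shiftmap:
  "agree (Suc n) v w \<longleftrightarrow> v 0 = w 0 \<and> agree n (shiftmap v) (shiftmap w)"
  by (auto simp: agree_def shiftmap_def less_Suc_eq_0_disj)

lemma wcons_0 [simp]: "wcons a w 0 = a"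
  by (simp add: wcons_def)

lemma shiftmap_wcons [simp]: "shiftmap (wcons a w) = w"
  by (simp add: wcons_def shiftmap_def)

lemma wcons_shiftmap [simp]: "wcons (w 0) (shiftmap w) = w"
  by (rule ext) (simp add: wcons_def shiftmap_def split: nat.split)

lemma wcons_eq_iff [simp]: "wcons a v = wcons b w \<longleftrightarrow> a = b \<and> v = w"
  by (metis wcons_0 shiftmap_wcons)

lemma agree_wcons [simp]: "agree (Suc n) (wcons a v) (wcons a w) \<longleftrightarrow> agree n v w"
  by (simp add: agree_Suc_iff_shiftmap)

lemma agree_wconsI: "agree n v w \<Longrightarrow> agree n (wcons a v) (wcons a w)"
  by (rule agree_mono[of "Suc n"]) simp_all

lemma funpow_shiftmap: "(shiftmap ^^ k) w = (\<lambda>i. w (k + i))"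
  by (induction k) (auto simp: shiftmap_def)

lemma prefix_eq_iff_agree: "map v [0..<n] = map w [0..<n] \<longleftrightarrow> agree n v w"
  by (auto simp: agree_def)

notation lex_less (infix "\<sqsubset>" 50)
notation lex_le (infix "\<sqsubseteq>" 50)

lemma lex_less_alt: "v \<sqsubset> w \<longleftrightarrow> (\<exists>n. agree n v w \<and> v n < w n)"
  by (simp add: lex_less_def agree_def)

lemma neq_first_difference:
  assumes "v \<noteq> w"
  obtains n where "agree n v w" "v n \<noteq> w n"
proof -
  have "\<exists>n. v n \<noteq> w n" using assms by auto
  then obtain n where "v n \<noteq> w n" "\<And>i. i < n \<Longrightarrow> v i = w i"
    using LeastI_ex[of "\<lambda>n. v n \<noteq> w n"] not_less_Least[of _ "\<lambda>n. v n \<noteq> w n"] by blast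
  then show thesis using that[of n] by (simp add: agree_def)
qed

lemma first_difference_unique:
  "agree m v w \<Longrightarrow> v m \<noteq> w m \<Longrightarrow> agree n v w \<Longrightarrow> v n \<noteq> w n \<Longrightarrow> m = n"
  by (meson agree_def linorder_neqE_nat)

lemma lex_less_total: "v \<sqsubset> w \<or> v = w \<or> w \<sqsubset> (v :: nat \<Rightarrow> 'a::linorder)"
proof (cases "v = w")
  case False
  then obtain n where "agree n v w" "v n \<noteq> w n" by (rule neq_first_difference)
  then show ?thesis
    unfolding lex_less_alt by (metis agree_sym neqE)
qed simp

lemma lex_less_trans: 
  assumes "u \<sqsubset> v" "v \<sqsubset> (w :: nat \<Rightarrow> 'a::linorder)" shows "u \<sqsubset> w"
proof -
  obtain n where n: "agree n u v" "u n < v n" using assms lex_less_alt by blast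
  obtain m where m: "agree m v w" "v m < w m" using assms lex_less_alt by blast
  consider "n < m" | "n = m" | "m < n" by linarith
  then show ?thesis
  proof cases
    case 1
    then have "agree n u w" "u n < w n"
      using n m by (auto simp: agree_def)
    then show ?thesis using lex_less_alt by blast
  next
    case 2
    then have "agree n u w" "u n < w n"
      using n m by (auto simp: agree_def)
    then show ?thesis using lex_less_alt by blast
  next
    case 3
    then have "agree m u w" "u m < w m"
      using n m by (auto simp: agree_def)
    then show ?thesis using lex_less_alt by blast
  qed
qed

lemma lex_less_irrefl: "\<not> w \<sqsubset> (w :: nat \<Rightarrow> 'a::linorder)"
  by (simp add: lex_less_def)

text \<open>Functions already carry the pointwise order as a class instance, so the lexicographic
  order enters as a locale interpretation with the prefix \<open>lex\<close>.\<close>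

interpretation lex: linorder "lex_le :: (nat \<Rightarrow> 'a::linorder) \<Rightarrow> _" lex_less
proof
  fix x y z :: "nat \<Rightarrow> 'a"
  show "x \<sqsubset> y \<longleftrightarrow> x \<sqsubseteq> y \<and> \<not> y \<sqsubseteq> x"
    unfolding lex_le_def using lex_less_irrefl lex_less_trans by metis
  show "x \<sqsubseteq> x" by (simp add: lex_le_def)
  show "x \<sqsubseteq> y \<Longrightarrow> y \<sqsubseteq> z \<Longrightarrow> x \<sqsubseteq> z"
    unfolding lex_le_def using lex_less_trans by metis
  show "x \<sqsubseteq> y \<Longrightarrow> y \<sqsubseteq> x \<Longrightarrow> x = y"
    unfolding lex_le_def using lex_less_irrefl lex_less_trans by metis
  show "x \<sqsubseteq> y \<or> y \<sqsubseteq> x"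
    unfolding lex_le_def using lex_less_total by metis
qed

declare lex.less_imp_le [simp]

lemma lex_antisym: "v \<sqsubseteq> w \<Longrightarrow> w \<sqsubseteq> v \<Longrightarrow> v = (w :: nat \<Rightarrow> 'a::linorder)"
  unfolding lex_le_def using lex_less_irrefl lex_less_trans by metis

lemma lex_lessE:
  assumes "v \<sqsubset> w" obtains n where "agree n v w" "v n < w n"
  using assms lex_less_alt by blast

lemma lex_lessI: "agree n v w \<Longrightarrow> v n < w n \<Longrightarrow> v \<sqsubset> w"
  using lex_less_alt by blast

lemma lex_less_first_difference:
  fixes v w :: "nat \<Rightarrow> 'a::linorder"
  assumes "v \<sqsubset> w" "agree n v w" "v n \<noteq> w n" shows "v n < w n"
  using assms by (metis first_difference_unique lex_lessE less_irrefl)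

text \<open>Cylinders are convex: a first difference of \<open>z\<close> from \<open>u\<close>
  before index \<open>n\<close> would be an increase, and would put \<open>z\<close> above
  \<open>v\<close> as well.\<close>

lemma agree_between:
  assumes "u \<sqsubseteq> z" "z \<sqsubseteq> v" "agree n u (v :: nat \<Rightarrow> 'a::linorder)"
  shows "agree n u z"
proof (cases "u = z")
  case False
  show ?thesis
  proof (rule ccontr)
    assume "\<not> agree n u z"
    obtain k where k: "agree k u z" "u k \<noteq> z k" using False by (rule neq_first_difference)
    have "k < n" using \<open>\<not> agree n u z\<close> k(1) by (meson agree_mono linorder_not_less)
    have "u k < z k" using assms(1) False k lex_less_first_difference lex.le_neq_trans by metis
    have "v k = u k" "agree k v z" using \<open>k < n\<close> assms(3) k(1) by (auto simp: agree_def)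
    then have "v \<sqsubset> z" using \<open>u k < z k\<close> by (metis lex_lessI)
    then show False using assms(2) by auto
  qed
qed simp

lemma lex_less_agree_right:
  assumes "agree n u v" "u n < v n" "agree (Suc n) v v'" shows "u \<sqsubset> v'"
  using assms by (intro lex_lessI[of n]) (auto simp: agree_def)

lemma lex_less_agree_left:
  assumes "agree n u v" "u n < v n" "agree (Suc n) u u'" shows "u' \<sqsubset> v"
  using assms by (intro lex_lessI[of n]) (auto simp: agree_def)

lemma lex_less_wcons [simp]: "wcons a v \<sqsubset> wcons a w \<longleftrightarrow> v \<sqsubset> (w :: nat \<Rightarrow> 'a::linorder)"
proof
  assume "v \<sqsubset> w"
  then obtain n where "agree n v w" "v n < w n" by (rule lex_lessE)
  then show "wcons a v \<sqsubset> wcons a w"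
    by (intro lex_lessI[of "Suc n"]) (auto simp: wcons_def agree_def split: nat.split)
next
  assume "wcons a v \<sqsubset> wcons a w"
  then obtain n where n: "agree n (wcons a v) (wcons a w)" "wcons a v n < wcons a w n"
    by (rule lex_lessE)
  then obtain m where "n = Suc m" by (cases n) auto
  then show "v \<sqsubset> w" using n by (intro lex_lessI[of m]) (auto simp: wcons_def agree_wcons[unfolded wcons_def])
qed

lemma lex_le_wcons [simp]: "wcons a v \<sqsubseteq> wcons a w \<longleftrightarrow> v \<sqsubseteq> (w :: nat \<Rightarrow> 'a::linorder)"
  by (metis lex.le_less lex_less_wcons wcons_eq_iff)

lemma shiftmap_less_iff:
  "v 0 = w 0 \<Longrightarrow> shiftmap v \<sqsubset> shiftmap w \<longleftrightarrow> v \<sqsubset> (w :: nat \<Rightarrow> 'a::linorder)"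
  by (metis lex_less_wcons wcons_shiftmap)

lemma shiftmap_le_iff:
  "v 0 = w 0 \<Longrightarrow> shiftmap v \<sqsubseteq> shiftmap w \<longleftrightarrow> v \<sqsubseteq> (w :: nat \<Rightarrow> 'a::linorder)"
  by (metis lex_le_wcons wcons_shiftmap)

lemma less_first_letter: "v 0 < w 0 \<Longrightarrow> v \<sqsubset> w"
  by (rule lex_lessI[of 0]) auto

lemma le_first_letter: "v \<sqsubseteq> w \<Longrightarrow> v 0 \<le> (w 0 :: 'a::linorder)"
  by (meson less_first_letter lex.not_less not_less)

section \<open>Topology of the word space: cylinders, cluster points, extremal words\<close>

lemma open_agree: "open {v :: nat \<Rightarrow> 'a::discrete_topology. agree n v w}"
proof -
  have "{v :: nat \<Rightarrow> 'a. agree n v w} = (\<Inter>i\<in>{..<n}. (\<lambda>v. v i) -` {w i})"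
    by (auto simp: agree_def)
  moreover have "open ((\<lambda>v :: nat \<Rightarrow> 'a. v i) -` S)" for S i
    by (rule open_vimage[OF Topological_Spaces.open_discrete continuous_on_product_coordinates])
  ultimately show ?thesis by auto
qed

lemma open_contains_cylinder:
  assumes "open U" "w \<in> (U :: (nat \<Rightarrow> 'a::topological_space) set)"
  obtains n where "\<And>v. agree n v w \<Longrightarrow> v \<in> U"
proof -
  obtain X where X: "w \<in> (\<Pi>\<^sub>E i\<in>UNIV. X i)" "\<And>i. open (X i)" "finite {i. X i \<noteq> UNIV}"
      "(\<Pi>\<^sub>E i\<in>UNIV. X i) \<subseteq> U"
    using product_topology_open_contains_basis[of "\<lambda>i. euclidean :: 'a topology" UNIV U w] assms
    by (auto simp: open_fun_def)
  obtain n where n: "\<And>i. X i \<noteq> UNIV \<Longrightarrow> i < n"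
    using X(3) by (metis (mono_tags) finite_nat_set_iff_bounded mem_Collect_eq)
  have "v \<in> U" if "agree n v w" for v
    using that X(1,4) n by (auto simp: agree_def PiE_iff subset_iff) (metis UNIV_I)
  then show thesis using that by blast
qed

text \<open>Cylinders form a base of the topology. Later closedness proofs all go through this
  criterion.\<close>

lemma closed_iff_agree:
  "closed K \<longleftrightarrow> (\<forall>w. (\<forall>n. \<exists>v\<in>K. agree n v w) \<longrightarrow> (w :: nat \<Rightarrow> 'a::discrete_topology) \<in> K)"
proof
  assume "closed K"
  then show "\<forall>w. (\<forall>n. \<exists>v\<in>K. agree n v w) \<longrightarrow> w \<in> K"
    by (metis ComplI Compl_iff open_Compl open_contains_cylinder)
next
  assume K: "\<forall>w. (\<forall>n. \<exists>v\<in>K. agree n v w) \<longrightarrow> w \<in> K"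
  have "\<exists>T. open T \<and> w \<in> T \<and> T \<subseteq> - K" if w: "w \<in> - K" for w
  proof -
    obtain n where "\<forall>v\<in>K. \<not> agree n v w" using K w by blast
    then show ?thesis
      by (intro exI[of _ "{v. agree n v w}"]) (auto intro: open_agree)
  qed
  then have "open (- K)" by (subst open_subopen) auto
  then show "closed K" by (simp add: closed_def)
qed

lemma closedD_agree:
  "closed K \<Longrightarrow> (\<And>n. \<exists>v\<in>K. agree n v w) \<Longrightarrow> (w :: nat \<Rightarrow> 'a::discrete_topology) \<in> K"
  using closed_iff_agree by blast

lemma compact_UNIV_words: "compact (UNIV :: (nat \<Rightarrow> 'a::{finite,topological_space}) set)"
proof -
  have "compact_space (euclidean :: 'a topology)"
    by (simp add: compact_space_def finite_imp_compact)
  then have "compact_space (product_topology (\<lambda>i::nat. euclidean :: 'a topology) UNIV)"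
    by (simp add: compact_space_product_topology)
  then show ?thesis
    by (simp add: euclidean_product_topology compact_space_def)
qed

text \<open>Compactness, stated so that the same \<open>N\<close> bounds the index from below and
  measures the agreement: a property of \<open>z k\<close> that sharpens as \<open>k\<close> grows
  passes to the cluster point.\<close>

lemma words_cluster_point:
  fixes z :: "nat \<Rightarrow> nat \<Rightarrow> 'a::{finite,discrete_topology}"
  obtains w where "\<And>N. \<exists>k\<ge>N. agree N (z k) w"
proof -
  have "\<exists>w\<in>UNIV. inf (nhds w) (filtermap z sequentially) \<noteq> bot"
    using compact_UNIV_words[where 'a = 'a]
    unfolding compact_filter by (elim allE[of _ "filtermap z sequentially"]) (auto simp: filtermap_bot_iff)
  then obtain w where w: "inf (nhds w) (filtermap z sequentially) \<noteq> bot" by blast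
  have "\<exists>k\<ge>N. agree N (z k) w" for N
  proof (rule ccontr)
    assume "\<not> ?thesis"
    then have "eventually (\<lambda>v. \<not> agree N v w) (filtermap z sequentially)"
      by (auto simp: eventually_filtermap eventually_sequentially)
    moreover have "eventually (\<lambda>v. agree N v w) (nhds w)"
      unfolding eventually_nhds
      by (rule exI[of _ "{v. agree N v w}"]) (auto intro: open_agree)
    ultimately have "eventually (\<lambda>v. False) (inf (nhds w) (filtermap z sequentially))"
      unfolding eventually_inf by blast
    then show False using w by (simp add: trivial_limit_def)
  qed
  then show thesis using that by blast
qed

text \<open>The relation \<open>R\<close> will be \<open><\<close> or \<open>>\<close>, so one proof
  yields both the least and the greatest word. The word is built greedily: some word of
  \<open>K\<close> is optimal in its first \<open>N\<close> letters for every \<open>N\<close>, and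
  a cluster point of these words is optimal at every index.\<close>

lemma closed_words_extremal:
  fixes K :: "(nat \<Rightarrow> 'a::{finite,discrete_topology}) set"
  assumes K: "closed K" "K \<noteq> {}" and R: "\<And>x. \<not> R x x" "\<And>x y z. R x y \<Longrightarrow> R y z \<Longrightarrow> R x z"
  shows "\<exists>m\<in>K. \<forall>v\<in>K. \<forall>n. agree n v m \<longrightarrow> \<not> R (v n) (m n)"
proof -
  have wfR: "\<exists>a\<in>A. \<forall>b\<in>A. \<not> R b a" if "A \<noteq> {}" for A :: "'a set"
  proof -
    have "acyclic {(x, y). R x y}"
    proof -
      have "trans {(x, y). R x y}" using R(2) by (auto simp: trans_def)
      then show ?thesis using R(1) by (simp add: acyclic_def)
    qed
    then have "wf {(x, y). R x y}" by (intro finite_acyclic_wf) auto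
    then show ?thesis using that
      by (metis (mono_tags, lifting) all_not_in_conv case_prodI mem_Collect_eq wfE_min)
  qed
  have "\<exists>z\<in>K. \<forall>v\<in>K. \<forall>n<N. agree n v z \<longrightarrow> \<not> R (v n) (z n)" for N
  proof (induction N)
    case 0
    show ?case using K(2) by auto
  next
    case (Suc N)
    then obtain z where z: "z \<in> K" "\<And>v n. v \<in> K \<Longrightarrow> n < N \<Longrightarrow> agree n v z \<Longrightarrow> \<not> R (v n) (z n)"
      by blast
    \<comment> \<open>Keep the first \<open>N\<close> letters of \<open>z\<close> and optimise the
      next letter among the words of \<open>K\<close> that share them.\<close>
    let ?A = "(\<lambda>v. v N) ` {v \<in> K. agree N v z}"
    have "?A \<noteq> {}" using z(1) by auto
    then obtain y where y: "y \<in> K" "agree N y z" "\<And>v. v \<in> K \<Longrightarrow> agree N v z \<Longrightarrow> \<not> R (v N) (y N)"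
      using wfR[of ?A] by auto
    have "\<not> R (v n) (y n)" if "v \<in> K" "n < Suc N" "agree n v y" for v n
    proof (cases "n = N")
      case True
      then show ?thesis using y that by (meson agree_trans)
    next
      case False
      then have "n < N" using that by simp
      then have "agree n v z" "y n = z n"
        using that(3) y(2) by (auto simp: agree_def)
      then show ?thesis using z(2) that(1) \<open>n < N\<close> by metis
    qed
    then show ?case using y(1) by blast
  qed
  then obtain z where z: "\<And>N. z N \<in> K"
      "\<And>N v n. v \<in> K \<Longrightarrow> n < N \<Longrightarrow> agree n v (z N) \<Longrightarrow> \<not> R (v n) (z N n)"
    by metis
  obtain w where w: "\<And>N. \<exists>k\<ge>N. agree N (z k) w" using words_cluster_point by blast
  have "w \<in> K" using w z(1) by (intro closedD_agree[OF K(1)]) blast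
  moreover have "\<not> R (v n) (w n)" if v: "v \<in> K" "agree n v w" for v n
  proof -
    obtain k where k: "k \<ge> Suc n" "agree (Suc n) (z k) w" using w by blast
    then have "agree n v (z k)" "z k n = w n" using v(2) by (auto simp: agree_def)
    then show ?thesis using z(2)[of v n k] v(1) k(1) by simp
  qed
  ultimately show ?thesis by blast
qed

lemma closed_words_has_min:
  fixes K :: "(nat \<Rightarrow> 'a::{finite,linorder,discrete_topology}) set"
  assumes "closed K" "K \<noteq> {}"
  obtains m where "m \<in> K" "\<And>v. v \<in> K \<Longrightarrow> m \<sqsubseteq> v"
proof -
  obtain m where "m \<in> K" "\<forall>v\<in>K. \<forall>n. agree n v m \<longrightarrow> \<not> v n < m n"
    using closed_words_extremal[OF assms, of "(<)"] less_trans by blast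
  then show thesis using that lex.not_less lex_less_alt by metis
qed

lemma closed_words_has_max:
  fixes K :: "(nat \<Rightarrow> 'a::{finite,linorder,discrete_topology}) set"
  assumes "closed K" "K \<noteq> {}"
  obtains m where "m \<in> K" "\<And>v. v \<in> K \<Longrightarrow> v \<sqsubseteq> m"
proof -
  obtain m where "m \<in> K" "\<forall>v\<in>K. \<forall>n. agree n v m \<longrightarrow> \<not> m n < v n"
    using closed_words_extremal[OF assms, of "(>)"] less_trans by blast
  then show thesis using that lex.not_less lex_less_alt agree_sym by metis
qed

lemma open_lex_less_right: "open {v. w \<sqsubset> (v :: nat \<Rightarrow> 'a::{linorder,discrete_topology})}"
proof (subst open_subopen, intro ballI)
  fix v assume "v \<in> {v. w \<sqsubset> v}"
  then obtain n where "agree n w v" "w n < v n" using lex_lessE by blast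
  then show "\<exists>T. open T \<and> v \<in> T \<and> T \<subseteq> {v. w \<sqsubset> v}"
    by (intro exI[of _ "{u. agree (Suc n) u v}"])
      (auto intro: open_agree lex_less_agree_right agree_sym)
qed

lemma open_lex_less_left: "open {v. (v :: nat \<Rightarrow> 'a::{linorder,discrete_topology}) \<sqsubset> w}"
proof (subst open_subopen, intro ballI)
  fix v assume "v \<in> {v. v \<sqsubset> w}"
  then obtain n where "agree n v w" "v n < w n" using lex_lessE by blast
  then show "\<exists>T. open T \<and> v \<in> T \<and> T \<subseteq> {v. v \<sqsubset> w}"
    by (intro exI[of _ "{u. agree (Suc n) u v}"])
      (auto intro: open_agree lex_less_agree_left agree_sym)
qed

lemma closed_lex_le_right: "closed {v. w \<sqsubseteq> (v :: nat \<Rightarrow> 'a::{linorder,discrete_topology})}"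
proof -
  have "{v. w \<sqsubseteq> v} = - {v. v \<sqsubset> w}" by auto
  then show ?thesis by (simp add: closed_Compl open_lex_less_left)
qed

lemma closed_lex_le_left: "closed {v. (v :: nat \<Rightarrow> 'a::{linorder,discrete_topology}) \<sqsubseteq> w}"
proof -
  have "{v. v \<sqsubseteq> w} = - {v. w \<sqsubset> v}" by auto
  then show ?thesis by (simp add: closed_Compl open_lex_less_right)
qed

text \<open>Converts a finite set of cut points into the sequence format of the interval exchange
  definitions. It is applied to the discontinuities and to the points where the first letter
  changes.\<close>

lemma partition_sequence:
  fixes F :: "real set"
  assumes "finite F" "F \<subseteq> {0..1}"
  obtains xs :: "nat \<Rightarrow> real" and m where "xs 0 = 0" "xs m = 1" "\<And>i. i < m \<Longrightarrow> xs i < xs (Suc i)"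
    "\<And>i. i < m \<Longrightarrow> 0 \<le> xs i \<and> xs (Suc i) \<le> 1"
    "\<And>i. i < m \<Longrightarrow> F \<inter> {xs i<..<xs (Suc i)} = {}"
proof -
  let ?G = "insert 0 (insert 1 F)"
  have fin: "finite ?G" and G01: "?G \<subseteq> {0..1}" using assms by auto
  define l where "l = sorted_list_of_set ?G"
  have l: "sorted_wrt (<) l" "set l = ?G"
    unfolding l_def using fin set_sorted_list_of_set strict_sorted_list_of_set by blast+
  have lt: "l ! i < l ! j" if "i < j" "j < length l" for i j
    using l(1) that by (simp add: sorted_wrt_iff_nth_less)
  have len: "l \<noteq> []" using l(2) by auto
  have mem: "l ! i \<in> {0..1}" if "i < length l" for i
    using that l(2) G01 nth_mem by blast
  obtain i0 where i0: "i0 < length l" "l ! i0 = 0" using l(2) by (metis in_set_conv_nth insertI1)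
  obtain i1 where i1: "i1 < length l" "l ! i1 = 1"
    using l(2) by (metis in_set_conv_nth insertI1 insertI2)
  have "i0 = 0" using lt[of 0 i0] i0 mem[of 0] len by (cases i0) auto
  have "length l - 1 < length l" using len by simp
  then have "i1 = length l - 1" using lt[of i1 "length l - 1"] i1 mem[of "length l - 1"]
    by (cases "i1 < length l - 1") auto
  show thesis
  proof (rule that[of "\<lambda>i. l ! i" "length l - 1"])
    show "l ! 0 = 0" using i0 \<open>i0 = 0\<close> by simp
    show "l ! (length l - 1) = 1" using i1 \<open>i1 = length l - 1\<close> by simp
  next
    fix i assume i: "i < length l - 1"
    show "l ! i < l ! Suc i" using lt i by simp
    show "0 \<le> l ! i \<and> l ! Suc i \<le> 1" using mem[of i] mem[of "Suc i"] i by auto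
    show "F \<inter> {l ! i<..<l ! Suc i} = {}"
    proof (rule ccontr)
      assume "\<not> ?thesis"
      then obtain x where x: "x \<in> F" "l ! i < x" "x < l ! Suc i" by auto
      then obtain j where j: "j < length l" "x = l ! j"
        using l(2) by (metis in_set_conv_nth insertI2)
      have "i < length l" using i by simp
      then have "\<not> j \<le> i" using lt[of j i] x j i by (cases "j = i") auto
      moreover have "\<not> Suc i \<le> j" using lt[of "Suc i" j] x j i by (cases "j = Suc i") auto
      ultimately show False by simp
    qed
  qed
qed

lemma closed_finite_words:
  fixes K :: "(nat \<Rightarrow> 'a::discrete_topology) set"
  assumes "finite K" shows "closed K"
proof -
  have "closed {w}" for w :: "nat \<Rightarrow> 'a"
    unfolding closed_iff_agree by (auto intro: agree_all_imp_eq agree_sym)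
  then have "closed (\<Union>w\<in>K. {w})" using assms by (intro closed_UN) auto
  then show ?thesis by simp
qed

text \<open>If all increments from some index on exceeded a constant above the slope of the linear
  bound, the complexity would outgrow that bound.\<close>

lemma linear_complexity_small_increments:
  assumes "linear_complexity L"
  obtains C where "\<And>n0. \<exists>n\<ge>n0. complexity L (Suc n) \<le> complexity L n + C"
proof -
  obtain c where c: "c > 0" "\<forall>\<^sub>F n in sequentially. norm (real (complexity L n)) \<le> c * norm (real n)"
    using assms unfolding linear_complexity_def by (elim landau_o.bigE) auto
  then obtain n1 where n1: "\<And>n. n \<ge> n1 \<Longrightarrow> real (complexity L n) \<le> c * real n"
    by (auto simp: eventually_sequentially)
  \<comment> \<open>With \<open>C \<ge> c + 1\<close> the lower bound gains at least 1 per step on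
    the line of slope \<open>c\<close>; after more than \<open>c * n0\<close> steps this gain has
    used up the head start \<open>c * n0\<close>.\<close>
  define C where "C = nat \<lceil>c\<rceil> + 1"
  have C: "real C \<ge> c + 1" unfolding C_def by linarith
  have "\<exists>n\<ge>n0. complexity L (Suc n) \<le> complexity L n + C" for n0
  proof (rule ccontr)
    assume "\<not> ?thesis"
    then have step: "\<And>n. n \<ge> n0 \<Longrightarrow> complexity L (Suc n) > complexity L n + C" by force
    have "complexity L (n0 + k) \<ge> k * C" for k
    proof (induction k)
      case (Suc k)
      then show ?case using step[of "n0 + k"] by simp
    qed simp
    then have low: "real k * real C \<le> real (complexity L (n0 + k))" for k
      by (metis of_nat_le_iff of_nat_mult)
    obtain k where k: "real k > c * real n0" "k \<ge> n1"
      by (metis (no_types, opaque_lifting) linorder_not_le max.bounded_iff nle_le of_nat_le_iff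
          order_less_le_trans reals_Archimedean2)
    have "real k * (c + 1) \<le> real k * real C" using C by (intro mult_left_mono) auto
    also have "\<dots> \<le> c * real (n0 + k)" using low[of k] n1[of "n0 + k"] k(2) by simp
    finally show False using k(1) by (simp add: algebra_simps)
  qed
  then show thesis using that by blast
qed

subsection \<open>Invariant measures on minimal aperiodic shifts\<close>

locale minimal_measured_shift =
  fixes L :: "(nat \<Rightarrow> 'a::{finite, linorder, discrete_topology}) set"
    and \<mu> :: "(nat \<Rightarrow> 'a) measure"
  assumes shift_L: "is_shift L" and minimal_L: "minimal_shift L" and aperiodic_L: "aperiodic_shift L"
    and prob_\<mu>: "prob_space \<mu>" and sets_\<mu>: "sets \<mu> = sets (restrict_space borel L)"
    and invariant_\<mu>: "shift_invariant \<mu>"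
begin

sublocale prob_space \<mu> by (rule prob_\<mu>)

lemma closed_L: "closed L" using shift_L by (simp add: is_shift_def)

lemma L_nonempty: "L \<noteq> {}" using minimal_L by (simp add: minimal_shift_def)

lemma shiftmap_in_L: "w \<in> L \<Longrightarrow> shiftmap w \<in> L"
  using shift_L by (auto simp: is_shift_def)

lemma funpow_in_L: "w \<in> L \<Longrightarrow> (shiftmap ^^ k) w \<in> L"
  by (induction k) (auto simp: shiftmap_in_L)

lemma minimal_eqI:
  "K \<noteq> {} \<Longrightarrow> K \<subseteq> L \<Longrightarrow> closed K \<Longrightarrow> (\<And>w. w \<in> K \<Longrightarrow> shiftmap w \<in> K) \<Longrightarrow> K = L"
  using minimal_L unfolding minimal_shift_def by blast

text \<open>A periodic word has a finite, hence closed and invariant, orbit. By minimality this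
  orbit is all of \<open>L\<close>, against aperiodicity.\<close>

lemma no_periodic_word:
  assumes "w \<in> L" "p > 0" shows "(shiftmap ^^ p) w \<noteq> w"
proof
  assume p: "(shiftmap ^^ p) w = w"
  let ?O = "{(shiftmap ^^ k) w | k. True}"
  have "?O \<subseteq> (\<lambda>k. (shiftmap ^^ k) w) ` {..<p}"
  proof
    fix v assume "v \<in> ?O"
    then obtain k where "v = (shiftmap ^^ k) w" by blast
    then have "v = (shiftmap ^^ (k mod p)) w" using funpow_mod_eq[OF p] by metis
    then show "v \<in> (\<lambda>k. (shiftmap ^^ k) w) ` {..<p}" using assms(2) by simp
  qed
  then have "finite ?O" using finite_surj by blast
  then have "closed ?O" by (rule closed_finite_words)
  moreover have "?O \<subseteq> L" using assms(1) funpow_in_L by blast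
  moreover have "shiftmap v \<in> ?O" if v: "v \<in> ?O" for v
  proof -
    obtain k where "v = (shiftmap ^^ k) w" using v by blast
    then have "shiftmap v = (shiftmap ^^ Suc k) w" by simp
    then show ?thesis by blast
  qed
  ultimately have "L = ?O" using minimal_eqI[of ?O] by blast
  then show False using aperiodic_L p assms(2) unfolding aperiodic_shift_def by blast
qed

lemma inj_orbit: 
  assumes "w \<in> L" shows "inj (\<lambda>k. (shiftmap ^^ k) w)"
proof (rule linorder_injI)
  fix i j :: nat assume "i < j"
  have "(shiftmap ^^ (j - i)) ((shiftmap ^^ i) w) \<noteq> (shiftmap ^^ i) w"
    using no_periodic_word[OF funpow_in_L[OF assms]] \<open>i < j\<close> by simp
  moreover have "(shiftmap ^^ (j - i)) ((shiftmap ^^ i) w) = (shiftmap ^^ j) w"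
    using \<open>i < j\<close> by (simp add: funpow_add[symmetric, THEN fun_cong, unfolded comp_def])
  ultimately show "(shiftmap ^^ i) w \<noteq> (shiftmap ^^ j) w" by metis
qed

text \<open>The shift maps \<open>L\<close> onto \<open>L\<close>: the image is closed by
  compactness and invariant, so minimality applies.\<close>

lemma ex_left_extension:
  assumes "w \<in> L" shows "\<exists>e. wcons e w \<in> L"
proof -
  have "closed (shiftmap ` L)"
    unfolding closed_iff_agree
  proof (intro allI impI)
    fix w assume "\<forall>n. \<exists>v\<in>shiftmap ` L. agree n v w"
    then have "\<forall>n. \<exists>v. v \<in> L \<and> agree n (shiftmap v) w" by blast
    then obtain v where v: "\<And>n. v n \<in> L" "\<And>n. agree n (shiftmap (v n)) w" by metis
    obtain u where u: "\<And>N. \<exists>k\<ge>N. agree N (v k) u" using words_cluster_point by blast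
    have "u \<in> L" using u v(1) by (intro closedD_agree[OF closed_L]) blast
    moreover have "shiftmap u = w"
    proof (rule agree_all_imp_eq)
      fix N
      obtain k where k: "k \<ge> Suc N" "agree (Suc N) (v k) u" using u by blast
      then have "agree N (shiftmap u) (shiftmap (v k))" by (simp add: agree_shiftmap agree_sym)
      moreover have "agree N (shiftmap (v k)) w" using v(2) k(1) agree_mono by (metis Suc_leD)
      ultimately show "agree N (shiftmap u) w" by (rule agree_trans)
    qed
    ultimately show "w \<in> shiftmap ` L" by blast
  qed
  then have "shiftmap ` L = L"
    using L_nonempty shiftmap_in_L by (intro minimal_eqI) auto
  then show ?thesis using assms by (metis image_iff wcons_shiftmap)
qed

lemma space_\<mu>: "space \<mu> = L"
  using sets_eq_imp_space_eq[OF sets_\<mu>] by (simp add: space_restrict_space)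

lemma sets_borelI: "Collect P \<in> sets borel \<Longrightarrow> {v \<in> L. P v} \<in> sets \<mu>"
  unfolding sets_\<mu> sets_restrict_space by (auto simp: Int_def)

lemma sets_lex [simp]:
  "{v \<in> L. v \<sqsubseteq> w} \<in> sets \<mu>" "{v \<in> L. u \<sqsubset> v \<and> v \<sqsubseteq> w} \<in> sets \<mu>" "{v \<in> L. agree n v w} \<in> sets \<mu>"
proof -
  have 1: "{v. v \<sqsubseteq> w} \<in> sets borel" "{v. u \<sqsubset> v} \<in> sets borel" "{v. agree n v w} \<in> sets borel"
    by (simp_all add: closed_lex_le_left open_lex_less_right open_agree)
  then have "{v. u \<sqsubset> v} \<inter> {v. v \<sqsubseteq> w} \<in> sets borel" by blast
  then have "{v. u \<sqsubset> v \<and> v \<sqsubseteq> w} \<in> sets borel" by (simp add: Int_def)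
  with 1 show "{v \<in> L. v \<sqsubseteq> w} \<in> sets \<mu>" "{v \<in> L. u \<sqsubset> v \<and> v \<sqsubseteq> w} \<in> sets \<mu>" "{v \<in> L. agree n v w} \<in> sets \<mu>"
    by (simp_all add: sets_borelI)
qed

lemma sets_finite: 
  assumes "F \<subseteq> L" "finite F" shows "F \<in> sets \<mu>"
proof -
  have "F \<in> sets borel" using closed_finite_words[OF assms(2)] by (rule borel_closed)
  then have "{v \<in> L. v \<in> F} \<in> sets \<mu>" by (intro sets_borelI) simp
  moreover have "{v \<in> L. v \<in> F} = F" using assms(1) by auto
  ultimately show ?thesis by simp
qed

lemma shift_preimage:
  assumes "A \<in> sets \<mu>"
  shows "{v \<in> L. shiftmap v \<in> A} \<in> sets \<mu>" "measure \<mu> {v \<in> L. shiftmap v \<in> A} = measure \<mu> A"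
proof -
  have eq: "{v \<in> L. shiftmap v \<in> A} = shiftmap -` A \<inter> space \<mu>" by (auto simp: space_\<mu>)
  show "{v \<in> L. shiftmap v \<in> A} \<in> sets \<mu>"
    unfolding eq using invariant_\<mu> assms by (auto simp: shift_invariant_def intro: measurable_sets)
  show "measure \<mu> {v \<in> L. shiftmap v \<in> A} = measure \<mu> A"
    unfolding eq using invariant_\<mu> assms by (auto simp: shift_invariant_def measure_def)
qed

text \<open>The preimage of \<open>{shiftmap u}\<close> contains \<open>u\<close>, so by invariance
  point masses do not decrease along a forward orbit. The orbit is infinite, so a positive mass
  would make the total exceed 1.\<close>

lemma measure_singleton:
  assumes "w \<in> L" shows "measure \<mu> {w} = 0"
proof (rule ccontr)
  assume "measure \<mu> {w} \<noteq> 0"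
  then have pos: "measure \<mu> {w} > 0" by (simp add: zero_less_measure_iff)
  have ge: "measure \<mu> {(shiftmap ^^ k) w} \<ge> measure \<mu> {w}" for k
  proof (induction k)
    case (Suc k)
    let ?u = "(shiftmap ^^ k) w"
    have u: "?u \<in> L" using assms by (rule funpow_in_L)
    have S: "{shiftmap ?u} \<in> sets \<mu>" using shiftmap_in_L[OF u] by (intro sets_finite) auto
    have "measure \<mu> {?u} \<le> measure \<mu> {v \<in> L. shiftmap v \<in> {shiftmap ?u}}"
      using u shift_preimage(1)[OF S] by (intro finite_measure_mono) auto
    then show ?case using Suc shift_preimage(2)[OF S] by simp
  qed simp
  obtain N where N: "real N * measure \<mu> {w} > 1" using pos reals_Archimedean3 by blast
  let ?S = "(\<lambda>k. (shiftmap ^^ k) w) ` {..<N}"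
  have "measure \<mu> ?S = (\<Sum>x\<in>?S. measure \<mu> {x})"
    using assms by (intro finite_measure_eq_sum_singleton sets_finite) (auto simp: funpow_in_L)
  also have "\<dots> = (\<Sum>k<N. measure \<mu> {(shiftmap ^^ k) w})"
    using inj_orbit[OF assms] by (subst sum.reindex) (auto simp: inj_on_def)
  also have "\<dots> \<ge> (\<Sum>k<N. measure \<mu> {w})" by (intro sum_mono ge)
  finally have "measure \<mu> ?S > 1" using N by simp
  then show False using prob_le_1 by (meson not_le)
qed

lemma measure_finite_set:
  assumes "F \<subseteq> L" "finite F" shows "measure \<mu> F = 0"
proof -
  have "measure \<mu> F = (\<Sum>x\<in>F. measure \<mu> {x})"
    using assms by (intro finite_measure_eq_sum_singleton sets_finite) auto
  also have "\<dots> = 0" using assms measure_singleton by (intro sum.neutral) auto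
  finally show ?thesis .
qed

text \<open>Full support. If a cylinder is null, so are all its preimages under iterated shifts, and
  some word never visits it. The words that never visit it form a closed invariant set, which
  minimality makes equal to \<open>L\<close>; but \<open>w\<close> itself visits at time 0.\<close>

lemma cylinder_pos:
  assumes "w \<in> L" shows "measure \<mu> {v \<in> L. agree n v w} > 0"
proof (rule ccontr)
  assume "\<not> ?thesis"
  then have 0: "measure \<mu> {v \<in> L. agree n v w} = 0" by (simp add: zero_less_measure_iff)
  let ?S = "\<lambda>k. {v \<in> L. agree n ((shiftmap ^^ k) v) w}"
  have S: "?S k \<in> sets \<mu> \<and> measure \<mu> (?S k) = 0" for k
  proof (induction k)
    case 0
    then show ?case using \<open>measure \<mu> {v \<in> L. agree n v w} = 0\<close> by simp
  next
    case (Suc k)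
    have "?S (Suc k) = {v \<in> L. shiftmap v \<in> ?S k}"
      by (auto simp: funpow_swap1 shiftmap_in_L)
    then show ?case using shift_preimage[of "?S k"] Suc by simp
  qed
  let ?K = "{v \<in> L. \<forall>k. \<not> agree n ((shiftmap ^^ k) v) w}"
  have "?K \<noteq> {}"
  proof
    assume "?K = {}"
    then have "L = (\<Union>k. ?S k)" by auto
    moreover have "emeasure \<mu> (\<Union>k. ?S k) = 0"
      using S by (intro emeasure_UN_eq_0) (auto simp: emeasure_eq_measure)
    ultimately have "emeasure \<mu> (space \<mu>) = 0" by (simp add: space_\<mu>)
    then show False by (simp add: emeasure_space_1)
  qed
  moreover have "closed ?K"
    unfolding closed_iff_agree
  proof (intro allI impI)
    fix u assume u: "\<forall>N. \<exists>v\<in>?K. agree N v u"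
    have "u \<in> L" using u by (intro closedD_agree[OF closed_L]) blast
    moreover have "\<not> agree n ((shiftmap ^^ k) u) w" for k
    proof
      assume a: "agree n ((shiftmap ^^ k) u) w"
      obtain v where v: "v \<in> ?K" "agree (k + n) v u" using u by blast
      then have "agree n ((shiftmap ^^ k) v) ((shiftmap ^^ k) u)"
        by (auto simp: agree_def funpow_shiftmap)
      then have "agree n ((shiftmap ^^ k) v) w" using a by (rule agree_trans)
      then show False using v(1) by blast
    qed
    ultimately show "u \<in> ?K" by blast
  qed
  moreover have "shiftmap v \<in> ?K" if "v \<in> ?K" for v
  proof -
    have "\<not> agree n ((shiftmap ^^ k) (shiftmap v)) w" for k
      using that by (metis (mono_tags, lifting) comp_apply funpow_Suc_right mem_Collect_eq)
    then show ?thesis using that shiftmap_in_L by auto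
  qed
  ultimately have "?K = L" by (intro minimal_eqI) auto
  then have "\<not> agree n ((shiftmap ^^ 0) w) w" using assms by blast
  then show False by simp
qed

text \<open>The cylinders around \<open>w\<close> decrease to the null set \<open>{w}\<close>.
  Together with \<open>f_dist_agree\<close> this makes \<open>f\<close> continuous on
  \<open>L\<close>.\<close>

lemma cylinder_small:
  assumes "w \<in> L" "\<epsilon> > 0" shows "\<exists>n. measure \<mu> {v \<in> L. agree n v w} < \<epsilon>"
proof -
  let ?A = "\<lambda>n. {v \<in> L. agree n v w}"
  have "(\<lambda>n. measure \<mu> (?A n)) \<longlonglongrightarrow> measure \<mu> (\<Inter>n. ?A n)"
    by (rule finite_Lim_measure_decseq) (auto simp: decseq_def intro: agree_mono)
  moreover have "(\<Inter>n. ?A n) = {w}" using assms(1) agree_all_imp_eq by auto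
  ultimately have "(\<lambda>n. measure \<mu> (?A n)) \<longlonglongrightarrow> 0" using measure_singleton assms(1) by simp
  then have "\<forall>\<^sub>F n in sequentially. measure \<mu> (?A n) < \<epsilon>" using assms(2) by (rule order_tendstoD(2))
  then show ?thesis by (auto simp: eventually_sequentially)
qed

section \<open>The distribution function of \<mu> along the lexicographic order\<close>

abbreviation f where "f \<equiv> phi_mu L \<mu>"

lemma wmin: "wmin L \<in> L" "w \<in> L \<Longrightarrow> wmin L \<sqsubseteq> w"
proof -
  obtain m where m: "m \<in> L" "\<And>v. v \<in> L \<Longrightarrow> m \<sqsubseteq> v"
    using closed_words_has_min[OF closed_L L_nonempty] by blast
  then have "wmin L = m"
    unfolding wmin_def by (intro the_equality) (auto intro: lex_antisym)
  then show "wmin L \<in> L" "w \<in> L \<Longrightarrow> wmin L \<sqsubseteq> w" using m by auto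
qed

lemma f_eq: "f w = measure \<mu> {v \<in> L. v \<sqsubseteq> w}"
proof -
  have "lex_interval L (wmin L) w = {v \<in> L. v \<sqsubseteq> w}"
    using wmin(2) by (auto simp: lex_interval_def)
  then show ?thesis by (simp add: phi_mu_def)
qed

lemma f_range: "0 \<le> f w" "f w \<le> 1"
  by (simp_all add: f_eq)

lemma f_diff:
  assumes "u \<sqsubseteq> w" shows "f w - f u = measure \<mu> {v \<in> L. u \<sqsubset> v \<and> v \<sqsubseteq> w}"
proof -
  have "{v \<in> L. u \<sqsubset> v \<and> v \<sqsubseteq> w} = {v \<in> L. v \<sqsubseteq> w} - {v \<in> L. v \<sqsubseteq> u}" using assms by auto
  moreover have "{v \<in> L. v \<sqsubseteq> u} \<subseteq> {v \<in> L. v \<sqsubseteq> w}" using assms by auto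
  ultimately show ?thesis by (simp add: f_eq finite_measure_Diff)
qed

lemma f_mono: "u \<sqsubseteq> w \<Longrightarrow> f u \<le> f w"
  using f_diff[of u w] by (metis diff_ge_0_iff_ge measure_nonneg)

lemma f_wmin: "f (wmin L) = 0"
proof -
  have "{v \<in> L. v \<sqsubseteq> wmin L} = {wmin L}" using wmin by (auto intro: lex_antisym)
  then show ?thesis using measure_singleton[OF wmin(1)] by (simp add: f_eq)
qed

lemma f_max: "(\<And>v. v \<in> L \<Longrightarrow> v \<sqsubseteq> w) \<Longrightarrow> f w = 1"
proof -
  assume "\<And>v. v \<in> L \<Longrightarrow> v \<sqsubseteq> w"
  then have "{v \<in> L. v \<sqsubseteq> w} = space \<mu>" by (auto simp: space_\<mu>)
  then show ?thesis by (simp add: f_eq prob_space)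
qed

text \<open>A long enough cylinder around \<open>z\<close> fits between \<open>u\<close> and
  \<open>w\<close>, and it has positive measure.\<close>

lemma f_less_between:
  assumes "u \<sqsubset> z" "z \<sqsubset> w" "z \<in> L" shows "f u < f w"
proof -
  obtain n where n: "agree n u z" "u n < z n" using assms(1) by (rule lex_lessE)
  obtain m where m: "agree m z w" "z m < w m" using assms(2) by (rule lex_lessE)
  let ?k = "max (Suc n) (Suc m)"
  have "u \<sqsubset> v \<and> v \<sqsubset> w" if "agree ?k v z" for v
    using that lex_less_agree_right[OF n] lex_less_agree_left[OF m]
    by (meson agree_mono agree_sym max.cobounded1 max.cobounded2)
  then have "{v \<in> L. agree ?k v z} \<subseteq> {v \<in> L. u \<sqsubset> v \<and> v \<sqsubseteq> w}" using lex.less_imp_le by blast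
  then have "measure \<mu> {v \<in> L. agree ?k v z} \<le> measure \<mu> {v \<in> L. u \<sqsubset> v \<and> v \<sqsubseteq> w}"
    by (intro finite_measure_mono) auto
  then show ?thesis using cylinder_pos[OF assms(3), of ?k] f_diff[of u w] lex.less_trans[OF assms(1,2)] by auto
qed

text \<open>A modulus of continuity: by convexity of cylinders, everything between \<open>u\<close>
  and \<open>w\<close> lies in their common cylinder.\<close>

lemma f_dist_agree:
  assumes "u \<in> L" "w \<in> L" "agree n u w"
  shows "\<bar>f u - f w\<bar> \<le> measure \<mu> {v \<in> L. agree n v w}"
proof -
  have main: "f w - f u \<le> measure \<mu> {v \<in> L. agree n v u}" if "u \<sqsubseteq> w" "agree n u w" for u w
  proof -
    have "{v \<in> L. u \<sqsubset> v \<and> v \<sqsubseteq> w} \<subseteq> {v \<in> L. agree n v u}"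
      using that agree_between[of u _ w n] by (auto intro: agree_sym)
    then show ?thesis using f_diff[OF that(1)] by (simp add: finite_measure_mono)
  qed
  have eq: "{v \<in> L. agree n v u} = {v \<in> L. agree n v w}"
    using assms(3) by (auto intro: agree_trans agree_sym)
  show ?thesis
  proof (cases "u \<sqsubseteq> w")
    case True
    then show ?thesis using main[of u w] f_mono[of u w] assms(3) eq by auto
  next
    case False
    then have "w \<sqsubseteq> u" by auto
    then show ?thesis using main[of w u] f_mono[of w u] assms(3) by (auto intro: agree_sym)
  qed
qed

text \<open>These are the gaps of \<open>L\<close>. By \<open>f_consec\<close> and
  \<open>f_eq_imp_consec\<close> they are exactly the pairs of words that \<open>f\<close>
  identifies.\<close>

definition consec :: "(nat \<Rightarrow> 'a) \<Rightarrow> (nat \<Rightarrow> 'a) \<Rightarrow> bool" where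
  "consec u w \<longleftrightarrow> u \<in> L \<and> w \<in> L \<and> u \<sqsubset> w \<and> (\<forall>v\<in>L. v \<sqsubseteq> u \<or> w \<sqsubseteq> v)"

lemma f_consec: "consec u w \<Longrightarrow> f u = f w"
proof -
  assume c: "consec u w"
  then have "{v \<in> L. u \<sqsubset> v \<and> v \<sqsubseteq> w} = {w}"
    unfolding consec_def by (auto intro: lex_antisym)
  then show "f u = f w"
    using f_diff[of u w] c measure_singleton[of w] by (auto simp: consec_def)
qed

lemma f_eq_imp_consec: "u \<in> L \<Longrightarrow> w \<in> L \<Longrightarrow> u \<sqsubset> w \<Longrightarrow> f u = f w \<Longrightarrow> consec u w"
  unfolding consec_def using f_less_between by (metis lex.not_le order_less_irrefl)

text \<open>Three words in a row would have the same value, although the middle one forces a strict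
  increase. Hence no value is taken by more than two words.\<close>

lemma consec_not_consec: "consec u v \<Longrightarrow> \<not> consec v w"
  proof (intro notI)
  assume "consec u v" "consec v w"
  moreover from this have "f u < f w"
    unfolding consec_def by (intro f_less_between[of u v w]) auto
  ultimately have "f u < f w" "f u = f v" "f v = f w"
    using f_consec by blast+
  then show False by simp
qed

lemma f_less_iff: 
  assumes "u \<in> L" "w \<in> L" shows "f u < f w \<longleftrightarrow> u \<sqsubset> w \<and> \<not> consec u w"
proof
  assume lt: "f u < f w"
  then have "\<not> w \<sqsubseteq> u" using f_mono[of w u] by auto
  then show "u \<sqsubset> w \<and> \<not> consec u w" using lt f_consec[of u w] by auto
next
  assume "u \<sqsubset> w \<and> \<not> consec u w"
  then show "f u < f w" using f_mono[of u w] f_eq_imp_consec[OF assms] by fastforce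
qed

text \<open>Continuity of \<open>f\<close>, in the form in which greatest and least words of the
  sublevel and superlevel sets can be extracted.\<close>

lemma closed_f_sublevels: "closed {v \<in> L. f v \<le> x}" "closed {v \<in> L. x \<le> f v}"
proof -
  have *: "\<exists>v\<in>K. \<bar>f v - f w\<bar> < \<epsilon>" if K: "\<And>n. \<exists>v\<in>K. agree n v w" "K \<subseteq> L" "w \<in> L" "\<epsilon> > 0" for K w \<epsilon>
  proof -
    obtain n where n: "measure \<mu> {v \<in> L. agree n v w} < \<epsilon>" using cylinder_small[OF K(3,4)] by blast
    obtain v where v: "v \<in> K" "agree n v w" using K(1) by blast
    then have "\<bar>f v - f w\<bar> \<le> measure \<mu> {v \<in> L. agree n v w}"
      using K(2,3) by (intro f_dist_agree) auto
    then show ?thesis using n v by (intro bexI[of _ v]) auto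
  qed
  show "closed {v \<in> L. f v \<le> x}"
    unfolding closed_iff_agree
  proof (intro allI impI)
    fix w assume w: "\<forall>n. \<exists>v\<in>{v \<in> L. f v \<le> x}. agree n v w"
    have "w \<in> L" using w by (intro closedD_agree[OF closed_L]) blast
    moreover have "f w \<le> x"
    proof (rule ccontr)
      assume "\<not> f w \<le> x"
      then obtain v where "v \<in> {v \<in> L. f v \<le> x}" "\<bar>f v - f w\<bar> < f w - x"
        using *[of "{v \<in> L. f v \<le> x}" w "f w - x"] w \<open>w \<in> L\<close> by auto
      then show False by auto
    qed
    ultimately show "w \<in> {v \<in> L. f v \<le> x}" by simp
  qed
  show "closed {v \<in> L. x \<le> f v}"
    unfolding closed_iff_agree
  proof (intro allI impI)
    fix w assume w: "\<forall>n. \<exists>v\<in>{v \<in> L. x \<le> f v}. agree n v w"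
    have "w \<in> L" using w by (intro closedD_agree[OF closed_L]) blast
    moreover have "x \<le> f w"
    proof (rule ccontr)
      assume "\<not> x \<le> f w"
      then obtain v where "v \<in> {v \<in> L. x \<le> f v}" "\<bar>f v - f w\<bar> < x - f w"
        using *[of "{v \<in> L. x \<le> f v}" w "x - f w"] w \<open>w \<in> L\<close> by auto
      then show False by auto
    qed
    ultimately show "w \<in> {v \<in> L. x \<le> f v}" by simp
  qed
qed

text \<open>On \<open>[0,1]\<close>, \<open>W x\<close> is the \<open>\<phi>\<close>-preimage of \<open>x\<close> and \<open>Wl x\<close> that of \<open>x\<^sup>-\<close> if \<open>x \<in> Z\<^sub>0\<close>, else \<open>Wl x = W x\<close>;
  outside \<open>[0,1]\<close> both are arbitrary.\<close>

definition W :: "real \<Rightarrow> nat \<Rightarrow> 'a" where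
  "W x = (SOME w. w \<in> L \<and> f w = x \<and> (\<forall>v\<in>L. f v \<le> x \<longrightarrow> v \<sqsubseteq> w))"

definition Wl :: "real \<Rightarrow> nat \<Rightarrow> 'a" where
  "Wl x = (SOME w. w \<in> L \<and> f w = x \<and> (\<forall>v\<in>L. x \<le> f v \<longrightarrow> w \<sqsubseteq> v))"

text \<open>This includes that \<open>f\<close> maps \<open>L\<close> onto \<open>[0,1]\<close>. The
  greatest word with value at most \<open>x\<close> and the least word with value at least
  \<open>x\<close> leave no word between them; were their values different, they would be
  consecutive and so have equal values.\<close>

lemma W_Wl_ex:
  assumes "x \<in> {0..1}"
  shows "\<exists>w. w \<in> L \<and> f w = x \<and> (\<forall>v\<in>L. f v \<le> x \<longrightarrow> v \<sqsubseteq> w)"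
    "\<exists>w. w \<in> L \<and> f w = x \<and> (\<forall>v\<in>L. x \<le> f v \<longrightarrow> w \<sqsubseteq> v)"
proof -
  have "wmin L \<in> {v \<in> L. f v \<le> x}" using assms wmin f_wmin by simp
  then have "{v \<in> L. f v \<le> x} \<noteq> {}" by blast
  from closed_words_has_max[OF closed_f_sublevels(1) this]
  obtain w where "w \<in> {v \<in> L. f v \<le> x}" "\<And>v. v \<in> {v \<in> L. f v \<le> x} \<Longrightarrow> v \<sqsubseteq> w" by blast
  then have w: "w \<in> L" "f w \<le> x" "\<And>v. v \<in> L \<Longrightarrow> f v \<le> x \<Longrightarrow> v \<sqsubseteq> w" by auto
  obtain u where u: "u \<in> L" "\<And>v. v \<in> L \<Longrightarrow> v \<sqsubseteq> u"
    using closed_words_has_max[OF closed_L L_nonempty] by blast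
  then have "u \<in> {v \<in> L. x \<le> f v}" using assms f_max[of u] by simp
  then have "{v \<in> L. x \<le> f v} \<noteq> {}" by blast
  from closed_words_has_min[OF closed_f_sublevels(2) this]
  obtain m where "m \<in> {v \<in> L. x \<le> f v}" "\<And>v. v \<in> {v \<in> L. x \<le> f v} \<Longrightarrow> m \<sqsubseteq> v" by blast
  then have m: "m \<in> L" "x \<le> f m" "\<And>v. v \<in> L \<Longrightarrow> x \<le> f v \<Longrightarrow> m \<sqsubseteq> v" by auto
  have "f w = x \<and> f m = x"
  proof (rule ccontr)
    assume "\<not> ?thesis"
    then have "f w < f m" using w(2) m(2) by linarith
    then have "w \<sqsubset> m" using f_mono[of m w] by (auto simp: lex.not_le[symmetric])
    moreover have "v \<sqsubseteq> w \<or> m \<sqsubseteq> v" if "v \<in> L" for v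
      using w(3)[OF that] m(3)[OF that] by linarith
    ultimately have "consec w m" using w(1) m(1) by (simp add: consec_def)
    then show False using f_consec \<open>f w < f m\<close> by force
  qed
  then show "\<exists>w. w \<in> L \<and> f w = x \<and> (\<forall>v\<in>L. f v \<le> x \<longrightarrow> v \<sqsubseteq> w)"
    "\<exists>w. w \<in> L \<and> f w = x \<and> (\<forall>v\<in>L. x \<le> f v \<longrightarrow> w \<sqsubseteq> v)" using w m by blast+
qed

text \<open>The last fact is a Galois connection between words and reals; with its counterpart for
  \<open>Wl\<close> it carries most of the order arguments below.\<close>

lemma W:
  assumes "x \<in> {0..1}"
  shows "W x \<in> L" "f (W x) = x" "v \<in> L \<Longrightarrow> v \<sqsubseteq> W x \<longleftrightarrow> f v \<le> x"
  using someI_ex[OF W_Wl_ex(1)[OF assms], folded W_def] f_mono[of v "W x"] by auto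

lemma Wl:
  assumes "x \<in> {0..1}"
  shows "Wl x \<in> L" "f (Wl x) = x" "v \<in> L \<Longrightarrow> Wl x \<sqsubseteq> v \<longleftrightarrow> x \<le> f v"
  using someI_ex[OF W_Wl_ex(2)[OF assms], folded Wl_def] f_mono[of "Wl x" v] by auto

lemma f_in_01 [simp]: "f w \<in> {0..1}"
  using f_range by simp

lemma W_strict_mono: "x \<in> {0..1} \<Longrightarrow> y \<in> {0..1} \<Longrightarrow> x < y \<Longrightarrow> W x \<sqsubset> W y"
  using W by (metis lex.not_le linorder_not_le)

lemma Wl_le_W: "x \<in> {0..1} \<Longrightarrow> Wl x \<sqsubseteq> W x"
  using W Wl by auto

lemma Wl_W_consec: "x \<in> {0..1} \<Longrightarrow> Wl x \<noteq> W x \<Longrightarrow> consec (Wl x) (W x)"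
  using W Wl Wl_le_W by (intro f_eq_imp_consec) (auto simp: lex.less_le)

text \<open>The words \<open>u\<close> and \<open>w\<close> lie between \<open>Wl (f w)\<close> and
  \<open>W (f w)\<close>, which are themselves consecutive and so leave room for nothing
  else.\<close>

lemma consec_Wl_W:
  assumes "consec u w" shows "Wl (f w) = u" "W (f w) = w"
proof -
  have L: "u \<in> L" "w \<in> L" and uw: "u \<sqsubset> w" and eq: "f u = f w"
    using assms f_consec by (auto simp: consec_def)
  have 1: "Wl (f w) \<sqsubseteq> u" "w \<sqsubseteq> W (f w)"
    using W(3)[OF f_in_01, of w w] Wl(3)[OF f_in_01, of u w] L eq by simp_all
  then have c: "consec (Wl (f w)) (W (f w))" using uw by (intro Wl_W_consec[OF f_in_01]) auto
  then show "Wl (f w) = u" "W (f w) = w"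
    using 1 L uw unfolding consec_def by (metis lex_antisym lex.le_less_trans lex.less_le_trans lex.not_le)+
qed

lemma W_f_cases: "w \<in> L \<Longrightarrow> W (f w) = w \<or> consec w (W (f w))"
  by (metis W(1,2,3) f_eq_imp_consec f_in_01 lex.le_less order_refl)

subsection \<open>The conjugacy and the one-sided limits of the interval map\<close>

text \<open>By \<open>right_limit_W\<close>, \<open>W_f_right_limit\<close> and
  \<open>f_right_limit\<close> these are exactly the words \<open>W x\<close> with \<open>x\<close>
  in \<open>[0,1)\<close>. Since the shift preserves them, the interval map stays inside
  \<open>[0,1)\<close> and \<open>W\<close> intertwines it with the shift.\<close>

definition right_limit :: "(nat \<Rightarrow> 'a) \<Rightarrow> bool" where
  "right_limit w \<longleftrightarrow> w \<in> L \<and> (\<forall>n. \<exists>v\<in>L. w \<sqsubset> v \<and> agree n w v)"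

text \<open>If \<open>w\<close> is isolated from above, the words of \<open>L\<close> above
  \<open>w\<close> form a closed set, whose least element would be a successor of
  \<open>w\<close>.\<close>

lemma successor_or_right_limit:
  assumes "w \<in> L" "u \<in> L" "w \<sqsubset> u" "\<And>v. \<not> consec w v"
  shows "right_limit w"
proof (rule ccontr)
  assume "\<not> right_limit w"
  then obtain n where n: "\<And>v. v \<in> L \<Longrightarrow> w \<sqsubset> v \<Longrightarrow> \<not> agree n w v"
    using assms(1) unfolding right_limit_def by blast
  let ?K = "{v \<in> L. w \<sqsubset> v}"
  have "closed ?K"
    unfolding closed_iff_agree
  proof (intro allI impI)
    fix z assume z: "\<forall>n. \<exists>v\<in>?K. agree n v z"
    then have "z \<in> L" by (intro closedD_agree[OF closed_L]) blast
    obtain v where v: "v \<in> L" "w \<sqsubset> v" "agree n v z" using z by blast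
    obtain m where m: "agree m w v" "w m < v m" using v(2) by (rule lex_lessE)
    \<comment> \<open>The first difference between \<open>w\<close> and \<open>v\<close> occurs
      before index \<open>n\<close>, so the limit \<open>z\<close> inherits it.\<close>
    have "m < n" using n[OF v(1,2)] m(1) by (meson agree_mono not_le)
    then have "agree (Suc m) v z" using v(3) by (auto intro: agree_mono)
    then have "w \<sqsubset> z" using m by (intro lex_less_agree_right)
    then show "z \<in> ?K" using \<open>z \<in> L\<close> by simp
  qed
  moreover have "?K \<noteq> {}" using assms(2,3) by blast
  ultimately obtain m where m: "m \<in> ?K" "\<And>v. v \<in> ?K \<Longrightarrow> m \<sqsubseteq> v"
    using closed_words_has_min by blast
  then have "consec w m" unfolding consec_def using assms(1) lex.not_le by blast
  then show False using assms(4) by blast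
qed

lemma predecessor_or_left_limit:
  assumes "w \<in> L" "u \<in> L" "u \<sqsubset> w" "\<And>v. \<not> consec v w"
  shows "\<exists>v\<in>L. v \<sqsubset> w \<and> agree n v w"
proof (rule ccontr)
  assume "\<not> ?thesis"
  then have n: "\<And>v. v \<in> L \<Longrightarrow> v \<sqsubset> w \<Longrightarrow> \<not> agree n v w" by blast
  let ?K = "{v \<in> L. v \<sqsubset> w}"
  have "closed ?K"
    unfolding closed_iff_agree
  proof (intro allI impI)
    fix z assume z: "\<forall>n. \<exists>v\<in>?K. agree n v z"
    then have "z \<in> L" by (intro closedD_agree[OF closed_L]) blast
    obtain v where v: "v \<in> L" "v \<sqsubset> w" "agree n v z" using z by blast
    obtain m where m: "agree m v w" "v m < w m" using v(2) by (rule lex_lessE)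
    have "m < n" using n[OF v(1,2)] m(1) by (meson agree_mono not_le)
    then have "agree (Suc m) v z" using v(3) by (auto intro: agree_mono)
    then have "z \<sqsubset> w" using m by (intro lex_less_agree_left)
    then show "z \<in> ?K" using \<open>z \<in> L\<close> by simp
  qed
  moreover have "?K \<noteq> {}" using assms(2,3) by blast
  ultimately obtain m where m: "m \<in> ?K" "\<And>v. v \<in> ?K \<Longrightarrow> v \<sqsubseteq> m"
    using closed_words_has_max by blast
  then have "consec m w" unfolding consec_def using assms(1) lex.not_le by blast
  then show False using assms(4) by blast
qed

lemma right_limit_not_consec: "right_limit w \<Longrightarrow> \<not> consec w u"
proof
  assume w: "right_limit w" and u: "consec w u"
  then obtain n where n: "agree n w u" "w n < u n" unfolding consec_def using lex_lessE by blast
  obtain v where v: "v \<in> L" "w \<sqsubset> v" "agree (Suc n) w v" using w unfolding right_limit_def by blast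
  have "v \<sqsubset> u" using n v(3) by (intro lex_less_agree_left)
  then show False using u v(1,2) unfolding consec_def by (metis lex.not_le)
qed

text \<open>As the greatest word with its value, \<open>W x\<close> has no successor, and
  \<open>W 1\<close> lies above it.\<close>

lemma right_limit_W: assumes "x \<in> I01" shows "right_limit (W x)"
proof -
  have x: "x \<in> {0..1}" using assms by simp
  show ?thesis
  proof (rule successor_or_right_limit)
    show "W x \<in> L" "W 1 \<in> L" using W x by auto
    show "W x \<sqsubset> W 1" using W_strict_mono assms by simp
    show "\<not> consec (W x) v" for v
    proof
      assume "consec (W x) v"
      then have v: "v \<in> L" "W x \<sqsubset> v" "f (W x) = f v" using f_consec by (auto simp: consec_def)
      then have "v \<sqsubseteq> W x" using W(2)[OF x] W(3)[OF x, of v] by simp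
      then show False using v(2) by auto
    qed
  qed
qed

lemma W_f_right_limit: "right_limit w \<Longrightarrow> W (f w) = w"
  using W_f_cases right_limit_not_consec unfolding right_limit_def by blast

lemma f_right_limit: assumes "right_limit w" shows "f w \<in> I01"
proof -
  obtain v where v: "v \<in> L" "w \<sqsubset> v" using assms unfolding right_limit_def by blast
  have "f w \<noteq> 1"
  proof
    assume "f w = 1"
    then have "v \<sqsubseteq> W (f w)" using W(3)[OF f_in_01 v(1), of w] f_range(2)[of v] by simp
    then show False using v(2) W_f_right_limit[OF assms] by auto
  qed
  then show ?thesis using f_range[of w] by simp
qed

lemma right_limit_shiftmap: assumes "right_limit w" shows "right_limit (shiftmap w)"
  unfolding right_limit_def
proof (intro conjI allI)
  show "shiftmap w \<in> L" using assms shiftmap_in_L by (simp add: right_limit_def)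
  fix n
  obtain v where v: "v \<in> L" "w \<sqsubset> v" "agree (Suc n) w v" using assms unfolding right_limit_def by blast
  then have "shiftmap w \<sqsubset> shiftmap v" "agree n (shiftmap w) (shiftmap v)"
    using shiftmap_less_iff[of w v] by (auto simp: agree_Suc_iff_shiftmap)
  then show "\<exists>v\<in>L. shiftmap w \<sqsubset> v \<and> agree n (shiftmap w) v" using v(1) shiftmap_in_L by blast
qed

text \<open>The alphabet is finite: if each letter \<open>e\<close> failed beyond some length
  \<open>n e\<close>, a word that approximates \<open>w\<close> up to the largest of these lengths
  would have no left extension. This provides preimages under the interval map within
  \<open>[0,1)\<close>.\<close>

lemma right_limit_left_extension: assumes "right_limit w" shows "\<exists>e. right_limit (wcons e w)"
proof (rule ccontr)
  assume none: "\<not> ?thesis"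
  have "\<exists>n. \<forall>v. w \<sqsubset> v \<longrightarrow> agree n w v \<longrightarrow> wcons e v \<notin> L" for e
  proof (rule ccontr)
    assume "\<not> ?thesis"
    then have ex: "\<And>n. \<exists>v. w \<sqsubset> v \<and> agree n w v \<and> wcons e v \<in> L" by blast
    have near: "\<exists>v\<in>L. wcons e w \<sqsubset> v \<and> agree n (wcons e w) v" for n
    proof -
      obtain v where "w \<sqsubset> v" "agree n w v" "wcons e v \<in> L" using ex by blast
      then have "wcons e w \<sqsubset> wcons e v" "agree n (wcons e w) (wcons e v)"
        using agree_mono[of "Suc n" "wcons e w" "wcons e v" n] by auto
      then show ?thesis using \<open>wcons e v \<in> L\<close> by blast
    qed
    then have "wcons e w \<in> L" by (intro closedD_agree[OF closed_L]) (meson agree_sym)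
    then show False using near none unfolding right_limit_def by blast
  qed
  then obtain n where n: "\<And>e v. w \<sqsubset> v \<Longrightarrow> agree (n e) w v \<Longrightarrow> wcons e v \<notin> L" by metis
  obtain v where v: "v \<in> L" "w \<sqsubset> v" "agree (Max (range n)) w v" using assms unfolding right_limit_def by blast
  obtain e where "wcons e v \<in> L" using ex_left_extension[OF v(1)] by blast
  moreover have "agree (n e) w v" using v(3) by (rule agree_mono) simp
  ultimately show False using n v(2) by blast
qed

section \<open>The map \<open>phi\<close> as order isomorphism and homeomorphism\<close>

lemma phi_eq: assumes "w \<in> L" shows "phi L \<mu> w = (f w, W (f w) = w)"
proof -
  \<comment> \<open>The test in \<open>phi_def\<close> asks whether \<open>w\<close> is the lower
    word of a gap, which amounts to \<open>w\<close> not being the greatest word with its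
    value.\<close>
  have "(\<exists>w'. w' \<in> L \<and> w \<sqsubset> w' \<and> {v \<in> L. f v = f w} = {w, w'}) \<longleftrightarrow> W (f w) \<noteq> w"
  proof
    assume "\<exists>w'. w' \<in> L \<and> w \<sqsubset> w' \<and> {v \<in> L. f v = f w} = {w, w'}"
    then obtain w' where w': "w' \<in> L" "w \<sqsubset> w'" "{v \<in> L. f v = f w} = {w, w'}" by blast
    then have "f w' = f w" by blast
    then have "w' \<sqsubseteq> W (f w)" using W(3)[OF f_in_01 w'(1)] by simp
    then show "W (f w) \<noteq> w" using w'(2) by auto
  next
    assume "W (f w) \<noteq> w"
    then have c: "consec w (W (f w))" using W_f_cases assms by blast
    have "v = w \<or> v = W (f w)" if v: "v \<in> L" "f v = f w" for v
    proof (rule ccontr)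
      assume ne: "\<not> ?thesis"
      have "v \<sqsubseteq> W (f w)" using W(3)[OF f_in_01 v(1)] v(2) by simp
      then have "v \<sqsubset> w" using c ne v(1) unfolding consec_def
        by (metis lex_antisym lex.le_less)
      then have "consec v w" using f_eq_imp_consec v assms by blast
      then show False using c consec_not_consec by blast
    qed
    then have "{v \<in> L. f v = f w} = {w, W (f w)}" 
      using assms W(1,2)[OF f_in_01, of w] by blast
    then show "\<exists>w'. w' \<in> L \<and> w \<sqsubset> w' \<and> {v \<in> L. f v = f w} = {w, w'}"
      using c unfolding consec_def by blast
  qed
  then show ?thesis unfolding phi_def by simp
qed

text \<open>Values of \<open>f\<close> separate all words except consecutive ones; for those the
  Boolean component decides.\<close>

lemma ihat_less_phi: 
  assumes "u \<in> L" "w \<in> L" shows "ihat_less (phi L \<mu> u) (phi L \<mu> w) \<longleftrightarrow> u \<sqsubset> w"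
proof
  assume "ihat_less (phi L \<mu> u) (phi L \<mu> w)"
  then consider "f u < f w" | "f u = f w" "W (f u) \<noteq> u" "W (f w) = w"
    using assms by (auto simp: phi_eq ihat_less_def)
  then show "u \<sqsubset> w"
  proof cases
    case 1
    then show ?thesis using f_less_iff assms by blast
  next
    case 2
    then show ?thesis using W(3)[OF f_in_01 assms(1), of w] by (metis lex.le_less order_refl)
  qed
next
  assume less: "u \<sqsubset> w"
  show "ihat_less (phi L \<mu> u) (phi L \<mu> w)"
  proof (cases "consec u w")
    case True
    then have "W (f w) = w" "f u = f w" using consec_Wl_W f_consec by blast+
    then show ?thesis using assms less by (auto simp: phi_eq ihat_less_def)
  next
    case False
    then have "f u < f w" using f_less_iff assms less by blast
    then show ?thesis using assms by (simp add: phi_eq ihat_less_def)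
  qed
qed

lemma inj_phi: "inj_on (phi L \<mu>) L"
proof (rule inj_onI)
  fix u w assume "u \<in> L" "w \<in> L" "phi L \<mu> u = phi L \<mu> w"
  then show "u = w" using ihat_less_phi by (metis lex.less_irrefl lex.less_linear)
qed

lemma phi_W: "x \<in> {0..1} \<Longrightarrow> phi L \<mu> (W x) = (x, True)"
  by (simp add: phi_eq W)

lemma Z0_iff: "x \<in> Z0 L \<mu> \<longleftrightarrow> (\<exists>u w. consec u w \<and> f w = x)"
proof
  assume "x \<in> Z0 L \<mu>"
  then obtain v v' where v: "v \<in> L" "v' \<in> L" "v \<noteq> v'" "f v = x" "f v' = x"
    unfolding Z0_def by blast
  then consider "consec v v'" | "consec v' v" using f_eq_imp_consec by (metis lex.less_linear)
  then show "\<exists>u w. consec u w \<and> f w = x" using v(4,5) by cases blast+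
next
  assume "\<exists>u w. consec u w \<and> f w = x"
  then obtain u w where c: "consec u w" "f w = x" by blast
  then have "u \<in> L" "w \<in> L" "u \<noteq> w" "f u = x" using f_consec by (auto simp: consec_def)
  then show "x \<in> Z0 L \<mu>" unfolding Z0_def using c(2) f_in_01[of w] by auto
qed

lemma phi_image: "phi L \<mu> ` L = Ihat L \<mu>"
proof
  show "phi L \<mu> ` L \<subseteq> Ihat L \<mu>"
  proof
    fix p assume "p \<in> phi L \<mu> ` L"
    then obtain w where w: "w \<in> L" "p = phi L \<mu> w" by blast
    show "p \<in> Ihat L \<mu>"
    proof (cases "W (f w) = w")
      case True
      then show ?thesis using w f_in_01[of w] by (simp add: phi_eq Ihat_def)
    next
      case False
      then have "consec w (W (f w))" using w W_f_cases by blast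
      then have "f w \<in> Z0 L \<mu>" using W(2)[OF f_in_01] Z0_iff by blast
      then show ?thesis using w False by (simp add: phi_eq Ihat_def)
    qed
  qed
  show "Ihat L \<mu> \<subseteq> phi L \<mu> ` L"
  proof
    fix p assume "p \<in> Ihat L \<mu>"
    then consider x where "x \<in> {0..1}" "p = (x, True)" | z where "z \<in> Z0 L \<mu>" "p = (z, False)"
      unfolding Ihat_def by blast
    then show "p \<in> phi L \<mu> ` L"
    proof cases
      case 1
      then show ?thesis using phi_W W(1) by (metis imageI)
    next
      case 2
      then obtain u w where c: "consec u w" "f w = z" using Z0_iff by blast
      then have "u \<in> L" "u \<noteq> w" "W (f u) = w" "f u = z"
        using consec_Wl_W(2)[OF c(1)] f_consec[OF c(1)] by (simp_all add: consec_def lex.less_imp_neq)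
      then have "phi L \<mu> u = p" using 2 by (simp add: phi_eq)
      then show ?thesis using \<open>u \<in> L\<close> by blast
    qed
  qed
qed

lemma ihat_less_total: "p \<noteq> q \<Longrightarrow> ihat_less p q \<or> ihat_less q p"
  unfolding ihat_less_def by (cases p; cases q) auto

lemma openin_ihat:
  assumes "p \<in> S"
  shows "openin (ihat_topology S) {y \<in> S. ihat_less y p}" "openin (ihat_topology S) {y \<in> S. ihat_less p y}"
  unfolding ihat_topology_def by (rule topology_generated_by_Basis, use assms in blast)+

text \<open>The generating sets are open rays, so it must be checked that they cover: the ray below
  1 and the ray above 0 suffice.\<close>

lemma topspace_ihat: "topspace (ihat_topology (Ihat L \<mu>)) = Ihat L \<mu>"
proof
  show "topspace (ihat_topology (Ihat L \<mu>)) \<subseteq> Ihat L \<mu>"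
    unfolding ihat_topology_def topology_generated_by_topspace by auto
  have 01: "(0, True) \<in> Ihat L \<mu>" "(1, True) \<in> Ihat L \<mu>" by (auto simp: Ihat_def)
  show "Ihat L \<mu> \<subseteq> topspace (ihat_topology (Ihat L \<mu>))"
  proof
    fix p assume p: "p \<in> Ihat L \<mu>"
    have "ihat_less p (1, True) \<or> ihat_less (0, True) p"
      by (cases "fst p = 1") (use p in \<open>auto simp: ihat_less_def Ihat_def Z0_def\<close>)
    then show "p \<in> topspace (ihat_topology (Ihat L \<mu>))"
      using p openin_ihat[OF 01(1)] openin_ihat[OF 01(2)] openin_subset by blast
  qed
qed

lemma Hausdorff_ihat: "Hausdorff_space (ihat_topology (Ihat L \<mu>))"
proof -
  have sep: "\<exists>U V. openin (ihat_topology (Ihat L \<mu>)) U \<and> openin (ihat_topology (Ihat L \<mu>)) V \<and>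
       p \<in> U \<and> q \<in> V \<and> disjnt U V"
    if pq: "p \<in> Ihat L \<mu>" "q \<in> Ihat L \<mu>" "ihat_less p q" for p q
  \<comment> \<open>Separate by the two rays at a point in between if there is one. Otherwise the
    ray below \<open>q\<close> and the ray above \<open>p\<close> are already disjoint.\<close>
  proof (cases "\<exists>r\<in>Ihat L \<mu>. ihat_less p r \<and> ihat_less r q")
    case True
    then obtain r where r: "r \<in> Ihat L \<mu>" "ihat_less p r" "ihat_less r q" by blast
    show ?thesis
      using openin_ihat[OF r(1)] r pq
      by (intro exI[of _ "{y \<in> Ihat L \<mu>. ihat_less y r}"] exI[of _ "{y \<in> Ihat L \<mu>. ihat_less r y}"])
        (auto simp: disjnt_def ihat_less_def)
  next
    case False
    then show ?thesis
      using openin_ihat[OF pq(1)] openin_ihat[OF pq(2)] pq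
      by (intro exI[of _ "{y \<in> Ihat L \<mu>. ihat_less y q}"] exI[of _ "{y \<in> Ihat L \<mu>. ihat_less p y}"])
        (auto simp: disjnt_iff)
  qed
  show ?thesis
    unfolding Hausdorff_space_def topspace_ihat
  proof (intro allI impI)
    fix p q assume pq: "p \<in> Ihat L \<mu> \<and> q \<in> Ihat L \<mu> \<and> p \<noteq> q"
    then consider "ihat_less p q" | "ihat_less q p" using ihat_less_total by blast
    then show "\<exists>U V. openin (ihat_topology (Ihat L \<mu>)) U \<and> openin (ihat_topology (Ihat L \<mu>)) V \<and>
       p \<in> U \<and> q \<in> V \<and> disjnt U V"
    proof cases
      case 1
      then show ?thesis using sep pq by blast
    next
      case 2
      then show ?thesis using sep[of q p] pq disjnt_sym by metis
    qed
  qed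
qed

text \<open>A continuous bijection from a compact space to a Hausdorff space. Continuity holds
  because preimages of rays are lexicographic rays of \<open>L\<close>.\<close>

lemma phi_homeomorphic: "homeomorphic_map (subtopology euclidean L) (ihat_topology (Ihat L \<mu>)) (phi L \<mu>)"
proof (rule continuous_imp_homeomorphic_map)
  have "compact L" using compact_UNIV_words closed_L by (metis closed_Int_compact Int_UNIV_right)
  then show "compact_space (subtopology euclidean L)" by (simp add: compact_space_subtopology)
  show "Hausdorff_space (ihat_topology (Ihat L \<mu>))" by (rule Hausdorff_ihat)
  show "phi L \<mu> ` topspace (subtopology euclidean L) = topspace (ihat_topology (Ihat L \<mu>))"
    by (simp add: topspace_ihat phi_image)
  show "inj_on (phi L \<mu>) (topspace (subtopology euclidean L))" by (simp add: inj_phi)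
  show "continuous_map (subtopology euclidean L) (ihat_topology (Ihat L \<mu>)) (phi L \<mu>)"
    unfolding ihat_topology_def
  proof (rule continuous_on_generated_topo)
    fix U assume "U \<in> {{y \<in> Ihat L \<mu>. ihat_less y x} |x. x \<in> Ihat L \<mu>} \<union>
                 {{y \<in> Ihat L \<mu>. ihat_less x y} |x. x \<in> Ihat L \<mu>}"
    then obtain w where w: "w \<in> L" 
      and U: "U = {y \<in> Ihat L \<mu>. ihat_less y (phi L \<mu> w)} \<or> U = {y \<in> Ihat L \<mu>. ihat_less (phi L \<mu> w) y}"
      unfolding phi_image[symmetric] by blast
    have "phi L \<mu> -` U \<inter> L = L \<inter> {v. v \<sqsubset> w} \<or> phi L \<mu> -` U \<inter> L = L \<inter> {v. w \<sqsubset> v}"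
      using U
    proof
      assume "U = {y \<in> Ihat L \<mu>. ihat_less y (phi L \<mu> w)}"
      then have "phi L \<mu> -` U \<inter> L = L \<inter> {v. v \<sqsubset> w}"
        using ihat_less_phi w phi_image by auto
      then show ?thesis ..
    next
      assume "U = {y \<in> Ihat L \<mu>. ihat_less (phi L \<mu> w) y}"
      then have "phi L \<mu> -` U \<inter> L = L \<inter> {v. w \<sqsubset> v}"
        using ihat_less_phi w phi_image by auto
      then show ?thesis ..
    qed
    then show "openin (subtopology euclidean L) (phi L \<mu> -` U \<inter> topspace (subtopology euclidean L))"
      using open_lex_less_left[of w] open_lex_less_right[of w] by (auto simp: openin_open_Int)
  next
    show "phi L \<mu> ` topspace (subtopology euclidean L) \<subseteq>
      \<Union> ({{y \<in> Ihat L \<mu>. ihat_less y x} |x. x \<in> Ihat L \<mu>} \<union>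
         {{y \<in> Ihat L \<mu>. ihat_less x y} |x. x \<in> Ihat L \<mu>})"
      using topspace_ihat unfolding ihat_topology_def topology_generated_by_topspace
      by (simp add: phi_image)
  qed
qed

lemma That_phi: "w \<in> L \<Longrightarrow> That L \<mu> (phi L \<mu> w) = phi L \<mu> (shiftmap w)"
  by (simp add: That_def inv_into_f_f[OF inj_phi])

section \<open>The interval map: conjugacy with the shift, one-sided limits, discontinuities\<close>

abbreviation T where "T \<equiv> T_L L \<mu>"

lemma T_eq: "x \<in> {0..1} \<Longrightarrow> T x = f (shiftmap (W x))"
  using That_phi[OF W(1)[of x], unfolded phi_W]
  by (simp add: T_L_def iota_def kappa_def phi_eq[OF shiftmap_in_L[OF W(1)]] phi_W)

lemma W_T: "x \<in> I01 \<Longrightarrow> W (T x) = shiftmap (W x)"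
  using right_limit_W right_limit_shiftmap W_f_right_limit T_eq by simp

lemma T_in: "x \<in> I01 \<Longrightarrow> T x \<in> I01"
  using right_limit_W right_limit_shiftmap f_right_limit T_eq by simp

text \<open>The shift of \<open>W x\<close> is again a right limit, hence the greatest word with its
  value, so \<open>phi\<close> sends it to the upper copy.\<close>

lemma That_iota: assumes "x \<in> I01" shows "That L \<mu> (iota x) = iota (T x)"
proof -
  have x: "x \<in> {0..1}" using assms by simp
  have "That L \<mu> (iota x) = phi L \<mu> (shiftmap (W x))"
    using That_phi[OF W(1)[OF x]] phi_W[OF x] by (simp add: iota_def)
  also have "\<dots> = phi L \<mu> (W (T x))" using W_T[OF assms] by simp
  also have "\<dots> = iota (T x)" using T_in[OF assms] phi_W[of "T x"] by (simp add: iota_def)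
  finally show ?thesis .
qed

text \<open>As the least word with its value, \<open>Wl x\<close> has no predecessor and is
  approximated from below by some \<open>v\<close>. For \<open>t\<close> just below
  \<open>x\<close>, the word \<open>W t\<close> is squeezed between \<open>v\<close> and
  \<open>Wl x\<close>, so the shifted words agree for long.\<close>

lemma T_left_limit:
  assumes "x \<in> {0<..1}" shows "(T \<longlongrightarrow> f (shiftmap (Wl x))) (at_left x)"
proof (rule tendstoI)
  fix \<epsilon> :: real assume "\<epsilon> > 0"
  have x: "x \<in> {0..1}" using assms by simp
  let ?u = "shiftmap (Wl x)"
  have u: "?u \<in> L" using Wl(1)[OF x] by (rule shiftmap_in_L)
  obtain n where n: "measure \<mu> {v \<in> L. agree n v ?u} < \<epsilon>" using cylinder_small[OF u \<open>\<epsilon> > 0\<close>] by blast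
  have "\<exists>v\<in>L. v \<sqsubset> Wl x \<and> agree (Suc n) v (Wl x)"
  proof (rule predecessor_or_left_limit)
    show "Wl x \<in> L" "wmin L \<in> L" using Wl x wmin by auto
    show "wmin L \<sqsubset> Wl x" using Wl(3)[OF x, of "wmin L"] wmin(1) f_wmin assms
      by (auto simp: lex.not_le[symmetric])
    show "\<not> consec v (Wl x)" for v
    proof
      assume "consec v (Wl x)"
      then have v: "v \<in> L" "v \<sqsubset> Wl x" "f v = f (Wl x)" using f_consec by (auto simp: consec_def)
      then show False using Wl(2)[OF x] Wl(3)[OF x, of v] by auto
    qed
  qed
  then obtain v where v: "v \<in> L" "v \<sqsubset> Wl x" "agree (Suc n) v (Wl x)" by blast
  have "f v < x" using Wl(3)[OF x v(1)] v(2) by (metis lex.not_le linorder_not_le)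
  have "dist (T t) (f ?u) < \<epsilon>" if t: "t \<in> {f v<..<x}" for t
  proof -
    have t01: "t \<in> {0..1}" using t f_range[of v] x by auto
    have "v \<sqsubseteq> W t" using W(3)[OF t01 v(1)] t by simp
    moreover have "W t \<sqsubseteq> Wl x"
      using Wl(3)[OF x W(1)[OF t01]] W(2)[OF t01] t by (metis greaterThanLessThan_iff lex.linear not_le)
    ultimately have "agree (Suc n) v (W t)" using v(3) by (rule agree_between)
    then have "agree (Suc n) (W t) (Wl x)" using v(3) agree_sym agree_trans by blast
    then have "\<bar>f (shiftmap (W t)) - f ?u\<bar> \<le> measure \<mu> {v \<in> L. agree n v ?u}"
      using u shiftmap_in_L[OF W(1)[OF t01]] by (intro f_dist_agree agree_shiftmap)
    then show ?thesis using n T_eq[OF t01] by (simp add: dist_real_def)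
  qed
  then show "\<forall>\<^sub>F t in at_left x. dist (T t) (f ?u) < \<epsilon>"
    using \<open>f v < x\<close> by (intro eventually_at_leftI) auto
qed

lemma T_right_limit:
  assumes "x \<in> I01" shows "(T \<longlongrightarrow> T x) (at_right x)"
proof (rule tendstoI)
  fix \<epsilon> :: real assume "\<epsilon> > 0"
  have x: "x \<in> {0..1}" using assms by simp
  let ?u = "shiftmap (W x)"
  have u: "?u \<in> L" using W(1)[OF x] by (rule shiftmap_in_L)
  obtain n where n: "measure \<mu> {v \<in> L. agree n v ?u} < \<epsilon>" using cylinder_small[OF u \<open>\<epsilon> > 0\<close>] by blast
  obtain v where v: "v \<in> L" "W x \<sqsubset> v" "agree (Suc n) (W x) v"
    using right_limit_W[OF assms] unfolding right_limit_def by blast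
  have "x < f v" using W(3)[OF x v(1)] v(2) by (metis lex.not_le linorder_not_le)
  have "dist (T t) (T x) < \<epsilon>" if t: "t \<in> {x<..<f v}" for t
  proof -
    have t01: "t \<in> {0..1}" using t f_range[of v] x by auto
    have "W x \<sqsubseteq> W t" using W_strict_mono[OF x t01] t by simp
    moreover have "W t \<sqsubseteq> v" using W(3)[OF t01 v(1)] t by (metis greaterThanLessThan_iff lex.linear not_le)
    ultimately have "agree (Suc n) (W x) (W t)" using v(3) by (rule agree_between)
    then have "\<bar>f (shiftmap (W t)) - f ?u\<bar> \<le> measure \<mu> {v \<in> L. agree n v ?u}"
      using u shiftmap_in_L[OF W(1)[OF t01]] by (intro f_dist_agree agree_shiftmap agree_sym[of _ "W x"])
    then show ?thesis using n T_eq[OF t01] T_eq[OF x] by (simp add: dist_real_def)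
  qed
  then show "\<forall>\<^sub>F t in at_right x. dist (T t) (T x) < \<epsilon>"
    using \<open>x < f v\<close> by (intro eventually_at_rightI) auto
qed

lemma T_right_continuous:
  assumes "x \<in> I01" shows "continuous (at x within {x..<1}) T"
proof -
  have "at x within {x..<1} \<le> at_right x"
    unfolding at_within_def by (intro inf_mono) auto
  then show ?thesis
    unfolding continuous_within using T_right_limit[OF assms] by (rule tendsto_mono)
qed

text \<open>Right continuity is automatic, so only the left limit has to be compared with the value;
  at 0 there is no left side within \<open>[0,1)\<close>.\<close>

lemma discont_iff:
  assumes "x \<in> I01"
  shows "x \<in> discont T \<longleftrightarrow> 0 < x \<and> f (shiftmap (Wl x)) \<noteq> f (shiftmap (W x))"
proof (cases "x = 0")
  case True
  then show ?thesis using T_right_continuous[OF assms] by (simp add: discont_def)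
next
  case False
  then have x: "0 < x" "x < 1" using assms by auto
  have "at x within I01 = at x"
    using x by (intro at_within_interior) simp
  then have "continuous (at x within I01) T \<longleftrightarrow> (T \<longlongrightarrow> T x) (at_left x)"
    using T_right_limit[OF assms] by (simp add: continuous_within filterlim_at_split)
  also have "\<dots> \<longleftrightarrow> f (shiftmap (Wl x)) = T x"
    using T_left_limit[of x] x
    by (metis greaterThanAtMost_iff less_imp_le tendsto_unique trivial_limit_at_left_real)
  also have "\<dots> \<longleftrightarrow> f (shiftmap (Wl x)) = f (shiftmap (W x))"
    using T_eq[of x] assms by simp
  finally show ?thesis using assms x by (simp add: discont_def)
qed

subsection \<open>Counting special words and gaps\<close>

text \<open>By invariance of \<open>L\<close> under the shift, every factor is already a prefix of
  some word of \<open>L\<close>.\<close>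

lemma Fact_eq: "Fact L n = (\<lambda>w. map w [0..<n]) ` L"
proof
  show "Fact L n \<subseteq> (\<lambda>w. map w [0..<n]) ` L"
  proof
    fix q assume "q \<in> Fact L n"
    then obtain w k where "w \<in> L" "q = map (\<lambda>i. w (k + i)) [0..<n]" unfolding Fact_def by blast
    then have "(shiftmap ^^ k) w \<in> L" "q = map ((shiftmap ^^ k) w) [0..<n]"
      by (simp_all add: funpow_in_L) (simp add: funpow_shiftmap)
    then show "q \<in> (\<lambda>w. map w [0..<n]) ` L" by blast
  qed
  have "map w [0..<n] \<in> Fact L n" if "w \<in> L" for w
    unfolding Fact_def mem_Collect_eq
    by (rule exI[of _ w], rule exI[of _ 0]) (simp add: that)
  then show "(\<lambda>w. map w [0..<n]) ` L \<subseteq> Fact L n" by blast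
qed

lemma finite_Fact: "finite (Fact L n)"
proof -
  have "Fact L n \<subseteq> {xs. set xs \<subseteq> UNIV \<and> length xs = n}" unfolding Fact_eq by auto
  then show ?thesis by (rule finite_subset) (rule finite_lists_length_eq, simp)
qed

definition left_special :: "(nat \<Rightarrow> 'a) set" where
  "left_special = {s. \<exists>a b. a \<noteq> b \<and> wcons a s \<in> L \<and> wcons b s \<in> L}"

lemma map_wcons: "map (wcons e w) [0..<Suc n] = e # map w [0..<n]"
  by (simp add: upt_conv_Cons map_Suc_upt[symmetric] wcons_def del: upt_Suc)

text \<open>Every factor of length \<open>n\<close> has a left extension \<open>g\<close>, and the
  prefix of a left special word has a second one, \<open>h\<close>. Both choices are injective
  because deleting the first letter recovers the shorter factor.\<close>

lemma card_left_special_le: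
  assumes "finite X" "X \<subseteq> left_special" and inj: "inj_on (\<lambda>w. map w [0..<n]) X"
  shows "complexity L n + card X \<le> complexity L (Suc n)"
proof -
  have ext: "\<exists>r\<in>Fact L (Suc n). tl r = q" if q: "q \<in> Fact L n" for q
  proof -
    obtain w where w: "w \<in> L" "q = map w [0..<n]" using q unfolding Fact_eq by blast
    obtain e where "wcons e w \<in> L" using ex_left_extension[OF w(1)] by blast
    then have "map (wcons e w) [0..<Suc n] \<in> Fact L (Suc n)" unfolding Fact_eq by blast
    moreover have "tl (map (wcons e w) [0..<Suc n]) = q" using w(2) unfolding map_wcons by simp
    ultimately show ?thesis by blast
  qed
  then obtain g where g: "\<And>q. q \<in> Fact L n \<Longrightarrow> g q \<in> Fact L (Suc n) \<and> tl (g q) = q" by metis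
  have "\<exists>r\<in>Fact L (Suc n). tl r = map s [0..<n] \<and> r \<noteq> g (map s [0..<n])" if s: "s \<in> X" for s
  proof -
    obtain a b where ab: "a \<noteq> b" "wcons a s \<in> L" "wcons b s \<in> L"
      using s assms(2) unfolding left_special_def by blast
    then have "map (wcons a s) [0..<Suc n] \<in> Fact L (Suc n)" "map (wcons b s) [0..<Suc n] \<in> Fact L (Suc n)"
      unfolding Fact_eq by blast+
    then have "a # map s [0..<n] \<in> Fact L (Suc n)" "b # map s [0..<n] \<in> Fact L (Suc n)"
      unfolding map_wcons .
    then show ?thesis using ab(1) by (metis list.inject list.sel(3))
  qed
  then obtain h where h: "\<And>s. s \<in> X \<Longrightarrow> h s \<in> Fact L (Suc n) \<and> tl (h s) = map s [0..<n] \<and> h s \<noteq> g (map s [0..<n])"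
    by metis
  have "inj_on g (Fact L n)" using g by (metis inj_onI)
  moreover have "inj_on h X" using h inj unfolding inj_on_def by metis
  moreover have "g ` Fact L n \<inter> h ` X = {}"
  proof (rule ccontr)
    assume "\<not> ?thesis"
    then obtain q s where "q \<in> Fact L n" "s \<in> X" "g q = h s" by blast
    then show False using g h by metis
  qed
  ultimately have "card (g ` Fact L n \<union> h ` X) = complexity L n + card X"
    using assms(1) finite_Fact by (simp add: card_Un_disjoint card_image complexity_def)
  moreover have "g ` Fact L n \<union> h ` X \<subseteq> Fact L (Suc n)" using g h by blast
  ultimately show ?thesis
    unfolding complexity_def by (metis card_mono finite_Fact)
qed

text \<open>A relation rather than a function, so that values with a single word have no level. The
  bounds on \<open>x\<close> are there because \<open>W\<close> and \<open>Wl\<close> are arbitrary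
  outside \<open>[0,1]\<close>.\<close>

definition gap_level :: "nat \<Rightarrow> real \<Rightarrow> bool" where
  "gap_level n x \<longleftrightarrow> x \<in> {0..1} \<and> agree n (Wl x) (W x) \<and> Wl x n \<noteq> W x n"

lemma gap_level_unique: "gap_level m x \<Longrightarrow> gap_level n x \<Longrightarrow> m = n"
  unfolding gap_level_def using first_difference_unique by blast

lemma ex_gap_level: "x \<in> {0..1} \<Longrightarrow> Wl x \<noteq> W x \<Longrightarrow> \<exists>n. gap_level n x"
  unfolding gap_level_def using neq_first_difference by metis

lemma gap_level_consec: "gap_level n x \<Longrightarrow> consec (Wl x) (W x)"
  unfolding gap_level_def by (rule Wl_W_consec) auto

text \<open>In other words, \<open>W x\<close> is the least word of \<open>L\<close> with its prefix
  of length \<open>n + 1\<close>. A smaller one would be at most \<open>Wl x\<close>, and convexity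
  of cylinders would force \<open>Wl x\<close> to share that prefix.\<close>

lemma gap_level_no_agree:
  assumes "gap_level n x" "v \<in> L" "v \<sqsubset> W x" shows "\<not> agree (Suc n) v (W x)"
proof
  assume a: "agree (Suc n) v (W x)"
  have c: "consec (Wl x) (W x)" using assms(1) by (rule gap_level_consec)
  have "v \<sqsubseteq> Wl x" using c assms(2,3) unfolding consec_def by (metis lex.not_le)
  moreover have "Wl x \<sqsubseteq> W x" using c unfolding consec_def by simp
  ultimately have "agree (Suc n) v (Wl x)" using a by (rule agree_between)
  then have "Wl x n = W x n" using a by (simp add: agree_Suc)
  then show False using assms(1) unfolding gap_level_def by simp
qed

text \<open>Dual to the count of left special words, with right extensions. Each factor
  \<open>q\<close> of length \<open>n\<close> is extended along the least word \<open>k q\<close>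
  with prefix \<open>q\<close>; the upper word of a gap of level \<open>n\<close> gives a different
  extension, since the lower word has the same first \<open>n\<close> letters and is
  smaller.\<close>

lemma gap_level_count: "finite {x. gap_level n x}" "complexity L n + card {x. gap_level n x} \<le> complexity L (Suc n)"
proof -
  let ?X = "{x. gap_level n x}"
  define h where "h x = map (W x) [0..<Suc n]" for x
  have x01: "x \<in> {0..1}" if "gap_level n x" for x using that by (simp add: gap_level_def)
  have hF: "h ` ?X \<subseteq> Fact L (Suc n)" unfolding h_def Fact_eq using W(1)[OF x01] by blast
  have inj: "inj_on h ?X"
  proof (rule inj_onI)
    fix x y assume "x \<in> ?X" "y \<in> ?X" "h x = h y"
    then have l: "gap_level n x" "gap_level n y" and a: "agree (Suc n) (W x) (W y)"
      unfolding h_def prefix_eq_iff_agree by auto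
    have "W x = W y"
      using gap_level_no_agree[OF l(1) W(1)[OF x01[OF l(2)]]] gap_level_no_agree[OF l(2) W(1)[OF x01[OF l(1)]]]
        a agree_sym[OF a] by (metis lex.less_linear)
    then show "x = y" using W(2) x01 l by metis
  qed
  show fin: "finite ?X" using inj hF finite_Fact by (meson finite_imageD finite_subset)
  have "\<exists>m\<in>L. map m [0..<n] = q \<and> (\<forall>v\<in>L. map v [0..<n] = q \<longrightarrow> m \<sqsubseteq> v)" if q: "q \<in> Fact L n" for q
  proof -
    obtain w where w: "w \<in> L" "q = map w [0..<n]" using q unfolding Fact_eq by blast
    let ?K = "{v \<in> L. agree n v w}"
    have "closed ?K"
      unfolding closed_iff_agree
    proof (intro allI impI)
      fix u assume u: "\<forall>k. \<exists>v\<in>?K. agree k v u"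
      then have "u \<in> L" by (intro closedD_agree[OF closed_L]) blast
      moreover have "agree n u w" using u agree_sym agree_trans by blast
      ultimately show "u \<in> ?K" by simp
    qed
    moreover have "?K \<noteq> {}" using w(1) by auto
    ultimately obtain m where "m \<in> ?K" "\<And>v. v \<in> ?K \<Longrightarrow> m \<sqsubseteq> v"
      using closed_words_has_min by blast
    then show ?thesis unfolding w(2) prefix_eq_iff_agree by (intro bexI[of _ m]) auto
  qed
  then obtain k where k: "\<And>q. q \<in> Fact L n \<Longrightarrow> k q \<in> L" "\<And>q. q \<in> Fact L n \<Longrightarrow> map (k q) [0..<n] = q"
      "\<And>q v. q \<in> Fact L n \<Longrightarrow> v \<in> L \<Longrightarrow> map v [0..<n] = q \<Longrightarrow> k q \<sqsubseteq> v" by metis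
  define g where "g q = map (k q) [0..<Suc n]" for q
  have gF: "g ` Fact L n \<subseteq> Fact L (Suc n)" unfolding g_def Fact_eq[of "Suc n"] using k(1) by blast
  have injg: "inj_on g (Fact L n)"
  proof (rule inj_onI)
    fix q r assume qr: "q \<in> Fact L n" "r \<in> Fact L n" "g q = g r"
    then have "agree n (k q) (k r)" unfolding g_def prefix_eq_iff_agree by (auto simp: agree_Suc)
    then have "map (k q) [0..<n] = map (k r) [0..<n]" unfolding prefix_eq_iff_agree .
    then show "q = r" using k(2) qr by simp
  qed
  have "g ` Fact L n \<inter> h ` ?X = {}"
  proof (rule ccontr)
    assume "\<not> ?thesis"
    then obtain q x where qx: "q \<in> Fact L n" "gap_level n x" "g q = h x" by blast
    have a: "agree (Suc n) (k q) (W x)" using qx(3) unfolding g_def h_def prefix_eq_iff_agree .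
    have c: "consec (Wl x) (W x)" using gap_level_consec qx(2) .
    \<comment> \<open>Now \<open>Wl x\<close> competes in the minimum defining \<open>k q\<close>,
      so \<open>k q\<close> lies below \<open>W x\<close> although both share \<open>n + 1\<close>
      letters.\<close>
    have "agree n (k q) (Wl x)"
      using a qx(2) unfolding gap_level_def agree_Suc by (meson agree_sym agree_trans)
    then have "map (Wl x) [0..<n] = q" using k(2)[OF qx(1)] prefix_eq_iff_agree agree_sym by metis
    then have "k q \<sqsubseteq> Wl x" using k(3)[OF qx(1)] c unfolding consec_def by blast
    then have "k q \<sqsubset> W x" using c unfolding consec_def by auto
    then show False using gap_level_no_agree[OF qx(2) k(1)[OF qx(1)]] a by blast
  qed
  then have "card (g ` Fact L n \<union> h ` ?X) = complexity L n + card ?X"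
    using injg inj fin finite_Fact by (simp add: card_Un_disjoint card_image complexity_def)
  moreover have "g ` Fact L n \<union> h ` ?X \<subseteq> Fact L (Suc n)" using gF hF by blast
  ultimately show "complexity L n + card ?X \<le> complexity L (Suc n)"
    unfolding complexity_def by (metis card_mono finite_Fact)
qed

text \<open>Compactness: if \<open>a v\<close> and \<open>b z\<close> lie in \<open>L\<close> and
  \<open>v\<close>, \<open>z\<close> agree longer and longer, they cluster at a common word that
  both letters extend. This locates left special words near discontinuities of high level.\<close>

lemma left_special_limit:
  "\<exists>N. \<forall>a b v z. a \<noteq> b \<longrightarrow> wcons a v \<in> L \<longrightarrow> wcons b z \<in> L \<longrightarrow> agree N v z \<longrightarrow>
     (\<exists>s. wcons a s \<in> L \<and> wcons b s \<in> L \<and> agree M s v)"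
proof -
  have "\<exists>N. \<forall>v z. wcons a v \<in> L \<longrightarrow> wcons b z \<in> L \<longrightarrow> agree N v z \<longrightarrow>
     (\<exists>s. wcons a s \<in> L \<and> wcons b s \<in> L \<and> agree M s v)" for a b
  proof (rule ccontr)
    assume "\<not> ?thesis"
    then have "\<forall>N. \<exists>v z. wcons a v \<in> L \<and> wcons b z \<in> L \<and> agree N v z \<and>
       (\<forall>s. wcons a s \<in> L \<longrightarrow> wcons b s \<in> L \<longrightarrow> \<not> agree M s v)" by blast
    then obtain v z where "\<forall>N. wcons a (v N) \<in> L \<and> wcons b (z N) \<in> L \<and> agree N (v N) (z N) \<and>
       (\<forall>s. wcons a s \<in> L \<longrightarrow> wcons b s \<in> L \<longrightarrow> \<not> agree M s (v N))"
      by (simp only: choice_iff) blast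
    then have vz: "\<And>N. wcons a (v N) \<in> L" "\<And>N. wcons b (z N) \<in> L" "\<And>N. agree N (v N) (z N)"
      "\<And>N s. wcons a s \<in> L \<Longrightarrow> wcons b s \<in> L \<Longrightarrow> \<not> agree M s (v N)" by simp_all
    obtain s where s: "\<And>N. \<exists>k\<ge>N. agree N (v k) s" using words_cluster_point by blast
    have "wcons a s \<in> L"
    proof (rule closedD_agree[OF closed_L])
      fix n
      obtain k where "agree n (v k) s" using s by blast
      then have "agree n (wcons a (v k)) (wcons a s)" by (rule agree_wconsI)
      then show "\<exists>u\<in>L. agree n u (wcons a s)" using vz(1) by blast
    qed
    moreover have "wcons b s \<in> L"
    proof (rule closedD_agree[OF closed_L])
      fix n
      obtain k where "k \<ge> n" "agree n (v k) s" using s by blast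
      then have "agree n (z k) s" using vz(3)[of k] by (meson agree_mono agree_sym agree_trans)
      then have "agree n (wcons b (z k)) (wcons b s)" by (rule agree_wconsI)
      then show "\<exists>u\<in>L. agree n u (wcons b s)" using vz(2) by blast
    qed
    moreover obtain k where "agree M (v k) s" using s by blast
    ultimately show False using vz(4) agree_sym by blast
  qed
  then obtain N where N: "\<And>a b v z. wcons a v \<in> L \<Longrightarrow> wcons b z \<in> L \<Longrightarrow> agree (N a b) v z \<Longrightarrow>
     (\<exists>s. wcons a s \<in> L \<and> wcons b s \<in> L \<and> agree M s v)" by metis
  \<comment> \<open>There are finitely many pairs of letters, so one \<open>N\<close> serves all of
    them.\<close>
  have "N a b \<le> Max (range (\<lambda>(a, b). N a b))" for a b
    by (intro Max_ge) auto
  then show ?thesis using N agree_mono by meson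
qed

text \<open>A positive level means that both words start with the same letter. The jump then comes
  from a word \<open>z\<close> strictly between the two shifted words, and \<open>z\<close> cannot
  be extended by that letter without landing inside the gap.\<close>

lemma discont_gap:
  assumes "x \<in> discont T" "gap_level (Suc n) x"
  shows "\<exists>b z. b \<noteq> W x 0 \<and> wcons b z \<in> L \<and> agree n (shiftmap (W x)) z"
proof -
  have x: "x \<in> I01" using assms(1) by (simp add: discont_def)
  have c: "consec (Wl x) (W x)" using assms(2) by (rule gap_level_consec)
  have ag: "agree (Suc n) (Wl x) (W x)" using assms(2) by (simp add: gap_level_def)
  then have eq0: "Wl x 0 = W x 0" and agn: "agree n (shiftmap (Wl x)) (shiftmap (W x))"
    by (simp_all add: agree_Suc_iff_shiftmap)
  have L: "shiftmap (Wl x) \<in> L" "shiftmap (W x) \<in> L" using c shiftmap_in_L unfolding consec_def by auto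
  have less: "shiftmap (Wl x) \<sqsubset> shiftmap (W x)"
    using c shiftmap_less_iff[of "Wl x" "W x", OF eq0] unfolding consec_def by simp
  have "\<not> consec (shiftmap (Wl x)) (shiftmap (W x))"
    using assms(1) discont_iff[OF x] f_consec by blast
  then obtain z where z: "z \<in> L" "shiftmap (Wl x) \<sqsubset> z" "z \<sqsubset> shiftmap (W x)"
    using L less unfolding consec_def by auto
  obtain b where b: "wcons b z \<in> L" using ex_left_extension[OF z(1)] by blast
  have "b \<noteq> W x 0"
  proof
    assume "b = W x 0"
    then have "Wl x \<sqsubset> wcons b z" "wcons b z \<sqsubset> W x"
      using z eq0 by (metis lex_less_wcons wcons_shiftmap)+
    then show False using c b unfolding consec_def by (metis lex.not_le)
  qed
  moreover have "agree n (shiftmap (Wl x)) z" using z agn by (intro agree_between[of _ z]) auto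
  ultimately show ?thesis using b agn agree_sym agree_trans by blast
qed

lemma W_funpow: "x \<in> I01 \<Longrightarrow> (T ^^ k) x \<in> I01 \<and> W ((T ^^ k) x) = (shiftmap ^^ k) (W x)"
proof (induction k)
  case (Suc k)
  then show ?case using T_in W_T by simp
qed simp

text \<open>Prefix \<open>W x\<close> by a letter that keeps it a right limit. Words of
  \<open>L\<close> just below the result would shift to words just below \<open>W x\<close>, which
  the gap at \<open>x\<close> forbids. So \<open>W y\<close> is isolated from below, and for
  \<open>y \<noteq> 0\<close> it is the upper word of a gap.\<close>

lemma gap_level_backward_step:
  assumes "x \<in> I01" "gap_level n x"
  shows "\<exists>y\<in>I01. T y = x \<and> (y = 0 \<or> (\<exists>m\<le>Suc n. gap_level m y))"
proof -
  obtain e where e: "right_limit (wcons e (W x))" using right_limit_left_extension[OF right_limit_W[OF assms(1)]] by blast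
  define y where "y = f (wcons e (W x))"
  have y: "y \<in> I01" "W y = wcons e (W x)" unfolding y_def using e f_right_limit W_f_right_limit by auto
  have y01: "y \<in> {0..1}" using y by simp
  have "T y = x" using T_eq[OF y01] y(2) W(2)[of x] assms(1) by simp
  \<comment> \<open>The level of \<open>x\<close> excludes agreement on \<open>n + 1\<close>
    letters; the new first letter adds one more.\<close>
  have no: "\<not> agree (Suc (Suc n)) v (W y)" if v: "v \<in> L" "v \<sqsubset> W y" for v
  proof
    assume a: "agree (Suc (Suc n)) v (W y)"
    then have "v 0 = e" "agree (Suc n) (shiftmap v) (W x)"
      using y(2) by (simp_all add: agree_Suc_iff_shiftmap[of "Suc n"])
    moreover have "shiftmap v \<sqsubset> W x"
      using v(2) y(2) \<open>v 0 = e\<close> shiftmap_less_iff[of v "W y"] by simp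
    ultimately show False using gap_level_no_agree[OF assms(2) shiftmap_in_L[OF v(1)]] by blast
  qed
  have "\<exists>m\<le>Suc n. gap_level m y" if "y \<noteq> 0"
  proof -
    have ne: "Wl y \<noteq> W y"
    proof
      assume eq: "Wl y = W y"
      have "wmin L \<noteq> W y" using f_wmin W(2)[OF y01] \<open>y \<noteq> 0\<close> by metis
      then have "wmin L \<sqsubset> W y" using wmin(2)[OF W(1)[OF y01]] by (simp add: lex.less_le)
      moreover have "\<not> consec v (W y)" for v
        using consec_Wl_W[of v "W y"] W(2)[OF y01] eq unfolding consec_def by auto
      ultimately have "\<exists>v\<in>L. v \<sqsubset> W y \<and> agree (Suc (Suc n)) v (W y)"
        using predecessor_or_left_limit W(1)[OF y01] wmin(1) by blast
      then show False using no by blast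
    qed
    then obtain m where m: "gap_level m y" using ex_gap_level y01 by blast
    have c: "consec (Wl y) (W y)" using m by (rule gap_level_consec)
    then have "\<not> agree (Suc (Suc n)) (Wl y) (W y)" using no unfolding consec_def by blast
    then have "\<not> Suc (Suc n) \<le> m" using m agree_mono unfolding gap_level_def by blast
    then show ?thesis using m by (intro exI[of _ m]) simp
  qed
  then show ?thesis using y(1) \<open>T y = x\<close> by blast
qed

text \<open>The aim is to move gaps of different initial levels to one prescribed level, where their
  number is bounded. The hypothesis \<open>no0\<close> keeps the backward orbit away from 0, the
  only point where the backward step may produce no gap.\<close>

lemma gap_level_backward_hits:
  assumes x: "x \<in> I01" "gap_level n x" and N: "n \<le> N" and no0: "\<And>k. (T ^^ k) 0 \<noteq> x"
  shows "\<exists>y k. y \<in> I01 \<and> (T ^^ k) y = x \<and> gap_level N y"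
proof -
  define P where "P i p \<longleftrightarrow> fst p \<in> I01 \<and> gap_level (snd p) (fst p) \<and> (T ^^ i) (fst p) = x" for i :: nat and p
  define Q where "Q p q \<longleftrightarrow> T (fst q) = fst p \<and> snd q \<le> Suc (snd p)" for p q :: "real \<times> nat"
  \<comment> \<open>Dependent choice of points together with their levels.\<close>
  have "\<exists>Y. \<forall>i. P i (Y i) \<and> Q (Y i) (Y (Suc i))"
  proof (rule dependent_nat_choice)
    show "\<exists>p. P 0 p" using x by (intro exI[of _ "(x, n)"]) (simp add: P_def)
    fix p i assume p: "P i p"
    then obtain y where y: "y \<in> I01" "T y = fst p" "y = 0 \<or> (\<exists>m\<le>Suc (snd p). gap_level m y)"
      using gap_level_backward_step unfolding P_def by blast
    have i: "(T ^^ Suc i) y = x" using p y(2) by (simp add: P_def funpow_swap1)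
    then obtain m where "m \<le> Suc (snd p)" "gap_level m y" using y(3) no0 by blast
    then show "\<exists>q. P (Suc i) q \<and> Q p q"
      using y i by (intro exI[of _ "(y, m)"]) (simp add: P_def Q_def)
  qed
  then obtain Y where Y: "\<And>i. P i (Y i)" "\<And>i. Q (Y i) (Y (Suc i))" by blast
  let ?y = "\<lambda>i. fst (Y i)" and ?n = "\<lambda>i. snd (Y i)"
  have I: "?y i \<in> I01" and lv: "gap_level (?n i) (?y i)" for i using Y(1)[of i] by (auto simp: P_def)
  have iterate: "(T ^^ d) (?y (i + d)) = ?y i" for i d
  proof (induction d)
    case (Suc d)
    have "(T ^^ Suc d) (?y (i + Suc d)) = (T ^^ d) (T (?y (Suc (i + d))))" by (simp add: funpow_swap1)
    also have "\<dots> = ?y i" using Y(2)[of "i + d"] Suc by (simp add: Q_def)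
    finally show ?case .
  qed simp
  \<comment> \<open>A repeated point would be periodic under \<open>T\<close>, so its word would be
    periodic under the shift.\<close>
  have inj: "inj ?y"
  proof (rule linorder_injI)
    fix i j :: nat assume "i < j"
    show "?y i \<noteq> ?y j"
    proof
      assume "?y i = ?y j"
      then have "(T ^^ (j - i)) (?y j) = ?y j" using iterate[of "j - i" i] \<open>i < j\<close> by simp
      then have "(shiftmap ^^ (j - i)) (W (?y j)) = W (?y j)" using W_funpow[OF I[of j]] by metis
      moreover have "W (?y j) \<in> L" using W(1) I[of j] by simp
      ultimately show False using no_periodic_word[of "W (?y j)" "j - i"] \<open>i < j\<close> by simp
    qed
  qed
  have "\<exists>i. ?n i \<ge> N"
  proof (rule ccontr)
    assume "\<not> ?thesis"
    then have "range ?y \<subseteq> (\<Union>m\<in>{..<N}. {x. gap_level m x})" using lv by (auto simp: not_le)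
    then have "finite (range ?y)" using gap_level_count(1) by (meson finite_UN finite_lessThan finite_subset)
    then show False using inj finite_imageD by blast
  qed
  then have "\<exists>i. ?n i \<ge> N \<and> (\<forall>j<i. \<not> ?n j \<ge> N)" using exists_least_iff[of "\<lambda>i. ?n i \<ge> N"] by blast
  then obtain i where i: "?n i \<ge> N" "\<And>j. j < i \<Longrightarrow> ?n j < N" by (auto simp: not_le)
  \<comment> \<open>At the first index with level at least \<open>N\<close> the level cannot
    overshoot: it rose from below \<open>N\<close> by at most 1, or the index is 0 and
    \<open>n \<le> N\<close> applies.\<close>
  have "?n i = N"
  proof (cases i)
    case 0
    then have "?y i = x" using Y(1)[of 0] by (simp add: P_def)
    then have "?n i = n" using lv[of i] x(2) gap_level_unique by metis
    then show ?thesis using i(1) N by simp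
  next
    case (Suc j)
    then show ?thesis using i(1) i(2)[of j] Y(2)[of j] by (simp add: Q_def)
  qed
  then show ?thesis using lv[of i] I[of i] Y(1)[of i] unfolding P_def by metis
qed

end

section \<open>Consequences of linear complexity for special words, accumulation points and
  orbits\<close>

locale linear_measured_shift = minimal_measured_shift L \<mu>
  for L :: "(nat \<Rightarrow> 'a::{finite, linorder, discrete_topology}) set" and \<mu> +
  assumes linear_L: "linear_complexity L"
begin

text \<open>For all large \<open>n\<close>, any \<open>C + 1\<close> left special words have
  distinct prefixes of length \<open>n\<close>, which contradicts an increment of at most
  \<open>C\<close> at one such \<open>n\<close>.\<close>

lemma finite_left_special: "finite left_special"
proof (rule ccontr)
  assume inf: "infinite left_special"
  obtain C where C: "\<And>n0. \<exists>n\<ge>n0. complexity L (Suc n) \<le> complexity L n + C"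
    using linear_complexity_small_increments[OF linear_L] by blast
  obtain X where X: "finite X" "card X = Suc C" "X \<subseteq> left_special"
    using inf infinite_arbitrarily_large by blast
  have "\<forall>\<^sub>F n in sequentially. agree n s t \<longrightarrow> s = t" for s t :: "nat \<Rightarrow> 'a"
  proof (cases "s = t")
    case False
    then obtain m where m: "agree m s t" "s m \<noteq> t m" by (rule neq_first_difference)
    have "\<not> agree n s t" if "n \<ge> Suc m" for n using that m(2) by (auto simp: agree_def intro!: exI[of _ m])
    then show ?thesis unfolding eventually_sequentially by blast
  qed simp
  then have "\<forall>\<^sub>F n in sequentially. \<forall>s\<in>X. \<forall>t\<in>X. agree n s t \<longrightarrow> s = t"
    using X(1) by (intro eventually_ball_finite ballI) auto
  then obtain n0 where n0: "\<And>n s t. n \<ge> n0 \<Longrightarrow> s \<in> X \<Longrightarrow> t \<in> X \<Longrightarrow> agree n s t \<Longrightarrow> s = t"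
    unfolding eventually_sequentially by blast
  obtain n where n: "n \<ge> n0" "complexity L (Suc n) \<le> complexity L n + C" using C by blast
  have "inj_on (\<lambda>w. map w [0..<n]) X" using n0[OF n(1)] unfolding inj_on_def prefix_eq_iff_agree by blast
  then have "complexity L n + card X \<le> complexity L (Suc n)" using card_left_special_le X by blast
  then show False using n(2) X(2) by simp
qed

lemma finite_left_special_extensions: "finite {wcons a s | a s. s \<in> left_special}"
proof -
  have "{wcons a s | a s. s \<in> left_special} = (\<lambda>(a, s). wcons a s) ` (UNIV \<times> left_special)" by auto
  then show ?thesis using finite_left_special by simp
qed

lemma finite_limit_points: "finite {y. y islimpt Dset T}"
proof -
  define E where "E = {wcons a s | a s. s \<in> left_special \<and> wcons a s \<in> L}"
  have finE: "finite E" using finite_left_special_extensions by (rule finite_subset[rotated]) (auto simp: E_def)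
  have EL: "E \<subseteq> L" by (auto simp: E_def)
  have "y \<in> f ` E" if lim: "y islimpt Dset T" for y
  proof (rule ccontr)
    assume y: "y \<notin> f ` E"
    have lim': "y islimpt discont T"
    proof -
      have "y islimpt closure (discont T)" using lim unfolding Dset_def by (rule islimpt_subset) auto
      then show ?thesis by (simp add: limpt_of_closure)
    qed
    obtain d where d0: "d > 0" "\<forall>x\<in>f ` E. x \<noteq> y \<longrightarrow> d \<le> dist y x"
      using finite_set_avoid[OF finite_imageI[OF finE, of f], of y] by (elim exE conjE)
    have d: "d > 0" "\<And>t. t \<in> E \<Longrightarrow> d \<le> dist y (f t)" using d0 y by auto
    have "\<forall>\<^sub>F n in sequentially. measure \<mu> {v \<in> L. agree n v t} < d / 2" if t: "t \<in> E" for t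
    proof -
      obtain n where n: "measure \<mu> {v \<in> L. agree n v t} < d / 2"
        using cylinder_small[of t "d / 2"] t EL d(1) by auto
      have "measure \<mu> {v \<in> L. agree k v t} < d / 2" if "k \<ge> n" for k
      proof -
        have "measure \<mu> {v \<in> L. agree k v t} \<le> measure \<mu> {v \<in> L. agree n v t}"
          using that by (intro finite_measure_mono) (auto intro: agree_mono)
        then show ?thesis using n by simp
      qed
      then show ?thesis unfolding eventually_sequentially by blast
    qed
    then have "\<forall>\<^sub>F n in sequentially. \<forall>t\<in>E. measure \<mu> {v \<in> L. agree n v t} < d / 2"
      using finE by (intro eventually_ball_finite) auto
    \<comment> \<open>A word that shares \<open>M + 1\<close> letters with some \<open>t\<close> in
      \<open>E\<close> has a value within \<open>d / 2\<close> of \<open>f t\<close>.\<close>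
    then obtain M where M: "\<And>t. t \<in> E \<Longrightarrow> measure \<mu> {v \<in> L. agree (Suc M) v t} < d / 2"
      unfolding eventually_sequentially by (metis le_SucI order_refl)
    obtain N where N: "\<And>a b v z. a \<noteq> b \<Longrightarrow> wcons a v \<in> L \<Longrightarrow> wcons b z \<in> L \<Longrightarrow> agree N v z \<Longrightarrow>
       (\<exists>s. wcons a s \<in> L \<and> wcons b s \<in> L \<and> agree M s v)"
      using left_special_limit[of M] by blast
    \<comment> \<open>A discontinuity within \<open>d / 2\<close> of \<open>y\<close> with level
      above \<open>N\<close> would produce a word \<open>?t\<close> in \<open>E\<close> whose value
      is within \<open>d / 2\<close> of \<open>x\<close>, hence closer than \<open>d\<close> to
      \<open>y\<close>.\<close>
    have "\<exists>k\<le>N. gap_level k x" if x: "x \<in> discont T" "x \<in> ball y (d / 2)" for x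
    proof (rule ccontr)
      assume none: "\<not> ?thesis"
      have xI: "x \<in> I01" using x(1) by (simp add: discont_def)
      then have x01: "x \<in> {0..1}" by simp
      have "Wl x \<noteq> W x" using discont_iff[OF xI] x(1) by auto
      then obtain k where k: "gap_level k x" using ex_gap_level x01 by blast
      then have "k > N" using none by (meson not_le)
      then obtain n where n: "k = Suc n" "n \<ge> N" by (cases k) auto
      obtain b z where bz: "b \<noteq> W x 0" "wcons b z \<in> L" "agree n (shiftmap (W x)) z"
        using discont_gap x(1) k n(1) by blast
      have "wcons (W x 0) (shiftmap (W x)) \<in> L" using W(1)[OF x01] by simp
      then obtain s where s: "wcons (W x 0) s \<in> L" "wcons b s \<in> L" "agree M s (shiftmap (W x))"
        using N[OF bz(1)[symmetric] _ bz(2) agree_mono[OF bz(3) n(2)]] by blast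
      let ?t = "wcons (W x 0) s"
      have "?t \<in> E" using s(1,2) bz(1) unfolding E_def left_special_def by blast
      have "agree (Suc M) (W x) ?t" using s(3) by (simp add: agree_Suc_iff_shiftmap agree_sym)
      then have "\<bar>f (W x) - f ?t\<bar> \<le> measure \<mu> {v \<in> L. agree (Suc M) v ?t}"
        using W(1)[OF x01] s(1) by (intro f_dist_agree)
      then have "\<bar>x - f ?t\<bar> < d / 2" using M[OF \<open>?t \<in> E\<close>] W(2)[OF x01] by simp
      moreover have "\<bar>y - x\<bar> < d / 2" using x(2) by (simp add: dist_real_def)
      moreover have "d \<le> \<bar>y - f ?t\<bar>" using d(2)[OF \<open>?t \<in> E\<close>] by (simp add: dist_real_def)
      ultimately show False by linarith
    qed
    then have "discont T \<inter> ball y (d / 2) \<subseteq> (\<Union>k\<in>{..N}. {x. gap_level k x})" by blast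
    then have "finite (discont T \<inter> ball y (d / 2))"
      using gap_level_count(1) by (meson finite_UN finite_atMost finite_subset)
    then show False using lim' d(1) unfolding islimpt_eq_infinite_ball by (meson half_gt_zero)
  qed
  then have "{y. y islimpt Dset T} \<subseteq> f ` E" by blast
  then show ?thesis by (rule finite_subset) (rule finite_imageI[OF finE])
qed

lemma discont_gap_level: "x \<in> discont T \<Longrightarrow> x \<in> I01 \<and> (\<exists>n. gap_level n x)"
proof -
  assume x: "x \<in> discont T"
  then have xI: "x \<in> I01" by (simp add: discont_def)
  then have "Wl x \<noteq> W x" using discont_iff x by auto
  then show ?thesis using ex_gap_level xI by simp
qed

lemma Dset_cases: "x \<in> Dset T \<Longrightarrow> x \<in> discont T \<or> x islimpt Dset T"
proof -
  assume x: "x \<in> Dset T"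
  then have "x \<in> discont T \<or> x islimpt discont T" unfolding Dset_def closure_def by blast
  moreover have "discont T \<subseteq> Dset T"
    unfolding Dset_def using closure_subset[of "discont T"] by (auto simp: discont_def)
  ultimately show ?thesis using islimpt_subset by blast
qed

text \<open>A set of gap points in pairwise different full orbits, all off the forward orbit of 0,
  has at most \<open>C\<close> elements. A largest such set together with 0 represents every
  gap.\<close>

lemma finite_orbit_representatives:
  "\<exists>F. finite F \<and> F \<subseteq> I01 \<and> (\<forall>x n. x \<in> I01 \<longrightarrow> gap_level n x \<longrightarrow> x \<in> (\<Union>z\<in>F. full_orbit T z))"
proof -
  obtain C where C: "\<And>n0. \<exists>n\<ge>n0. complexity L (Suc n) \<le> complexity L n + C"
    using linear_complexity_small_increments[OF linear_L] by blast
  define A where "A = {x \<in> I01. (\<exists>n. gap_level n x) \<and> (\<forall>k. (T ^^ k) 0 \<noteq> x)}"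
  define P where "P X \<longleftrightarrow> finite X \<and> X \<subseteq> A \<and> (\<forall>x\<in>X. \<forall>y\<in>X. x \<in> full_orbit T y \<longrightarrow> x = y)" for X
  have bound: "card X \<le> C" if X: "P X" for X
  proof -
    have X': "finite X" "X \<subseteq> A" "\<And>x y. x \<in> X \<Longrightarrow> y \<in> X \<Longrightarrow> x \<in> full_orbit T y \<Longrightarrow> x = y"
      using X unfolding P_def by auto
    have "\<forall>\<^sub>F N in sequentially. \<exists>n\<le>N. gap_level n x" if x: "x \<in> X" for x
    proof -
      obtain n where "gap_level n x" using x X'(2) unfolding A_def by blast
      then show ?thesis unfolding eventually_sequentially by blast
    qed
    then have "\<forall>\<^sub>F N in sequentially. \<forall>x\<in>X. \<exists>n\<le>N. gap_level n x"
      using X'(1) by (intro eventually_ball_finite) auto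
    then obtain N0 where N0: "\<And>N x. N \<ge> N0 \<Longrightarrow> x \<in> X \<Longrightarrow> \<exists>n\<le>N. gap_level n x"
      unfolding eventually_sequentially by blast
    \<comment> \<open>The level \<open>N\<close> is beyond the initial levels of all points of
      \<open>X\<close> and has a small increment, so every point can be traced back to level
      \<open>N\<close>, where at most \<open>C\<close> gaps exist.\<close>
    obtain N where N: "N \<ge> N0" "complexity L (Suc N) \<le> complexity L N + C" using C by blast
    have "\<exists>y k. y \<in> I01 \<and> (T ^^ k) y = x \<and> gap_level N y" if x: "x \<in> X" for x
    proof -
      obtain n where "n \<le> N" "gap_level n x" using N0 N(1) x by blast
      then show ?thesis using gap_level_backward_hits x X'(2) unfolding A_def by blast
    qed
    then have "\<forall>x\<in>X. \<exists>y. \<exists>k. y \<in> I01 \<and> (T ^^ k) y = x \<and> gap_level N y" by blast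
    then obtain Y where "\<forall>x\<in>X. \<exists>k. Y x \<in> I01 \<and> (T ^^ k) (Y x) = x \<and> gap_level N (Y x)"
      by (rule bchoice[THEN exE])
    moreover from bchoice[OF this] obtain K where
      "\<forall>x\<in>X. Y x \<in> I01 \<and> (T ^^ K x) (Y x) = x \<and> gap_level N (Y x)" ..
    ultimately have Y: "\<And>x. x \<in> X \<Longrightarrow> Y x \<in> I01" "\<And>x. x \<in> X \<Longrightarrow> (T ^^ K x) (Y x) = x"
        "\<And>x. x \<in> X \<Longrightarrow> gap_level N (Y x)" by blast+
    \<comment> \<open>A common traced-back point would put \<open>x\<close> and \<open>z\<close>
      into the same full orbit.\<close>
    have "inj_on Y X"
    proof (rule inj_onI)
      fix x z assume xz: "x \<in> X" "z \<in> X" "Y x = Y z"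
      have "(T ^^ K z) x = (T ^^ (K z + K x)) (Y x)" using Y(2)[OF xz(1)] by (simp add: funpow_add)
      also have "\<dots> = (T ^^ (K x + K z)) (Y z)" using xz(3) by (simp add: add.commute)
      also have "\<dots> = (T ^^ K x) z" using Y(2)[OF xz(2)] by (simp add: funpow_add)
      finally have "x \<in> full_orbit T z"
        unfolding full_orbit_def using xz(1) X'(2) by (auto simp: A_def)
      then show "x = z" using X'(3) xz by blast
    qed
    then have "card X = card (Y ` X)" by (simp add: card_image)
    also have "\<dots> \<le> card {x. gap_level N x}" using Y(3) gap_level_count(1) by (intro card_mono) auto
    also have "\<dots> \<le> C" using gap_level_count(2)[of N] N(2) by simp
    finally show ?thesis .
  qed
  have "P {}" by (simp add: P_def)
  then obtain X where X: "P X" "\<And>Y. P Y \<Longrightarrow> card Y \<le> card X"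
    using ex_has_greatest_nat[of P "{}" card "Suc C"] bound by (metis less_Suc_eq_le)
  have orbit_refl: "x \<in> full_orbit T x" if "x \<in> I01" for x
    unfolding full_orbit_def using that by blast
  have orbit_sym: "y \<in> full_orbit T x" if "x \<in> full_orbit T y" "y \<in> I01" for x y
    using that unfolding full_orbit_def by (auto dest: sym)
  have "x \<in> (\<Union>z\<in>insert 0 X. full_orbit T z)" if x: "x \<in> I01" "gap_level n x" for x n
  proof (rule ccontr)
    assume no: "x \<notin> (\<Union>z\<in>insert 0 X. full_orbit T z)"
    have "(T ^^ k) 0 \<noteq> x" for k
    proof
      assume "(T ^^ k) 0 = x"
      then have "(T ^^ 0) x = (T ^^ k) 0" by simp
      then have "x \<in> full_orbit T 0" unfolding full_orbit_def using x(1) by blast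
      then show False using no by blast
    qed
    then have xA: "x \<in> A" using x unfolding A_def by blast
    have "x \<notin> X" using no orbit_refl[OF x(1)] by blast
    have "P (insert x X)"
      unfolding P_def
    proof (intro conjI ballI impI)
      show "finite (insert x X)" "insert x X \<subseteq> A" using X(1) xA unfolding P_def by auto
      fix u v assume uv: "u \<in> insert x X" "v \<in> insert x X" "u \<in> full_orbit T v"
      show "u = v"
      proof (rule ccontr)
        assume "u \<noteq> v"
        then consider "u = x" "v \<in> X" | "u \<in> X" "v = x" | "u \<in> X" "v \<in> X" using uv by blast
        then show False
        proof cases
          case 1
          then show ?thesis using no uv(3) by blast
        next
          case 2
          then show ?thesis using no orbit_sym uv(3) x(1) by blast
        next
          case 3
          then show ?thesis using X(1) uv(3) \<open>u \<noteq> v\<close> unfolding P_def by blast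
        qed
      qed
    qed
    then have "card (insert x X) \<le> card X" using X(2) by blast
    then show False using \<open>x \<notin> X\<close> X(1) by (simp add: P_def)
  qed
  moreover have "finite (insert 0 X)" "insert 0 X \<subseteq> I01" using X(1) by (auto simp: P_def A_def)
  ultimately show ?thesis by (intro exI[of _ "insert 0 X"]) blast
qed

lemma Dset_orbits: "\<exists>F. finite F \<and> F \<subseteq> I01 \<and> Dset T \<subseteq> (\<Union>x\<in>F. full_orbit T x)"
proof -
  obtain F where F: "finite F" "F \<subseteq> I01" "\<And>x n. x \<in> I01 \<Longrightarrow> gap_level n x \<Longrightarrow> x \<in> (\<Union>z\<in>F. full_orbit T z)"
    using finite_orbit_representatives by blast
  \<comment> \<open>Accumulation points need not be gaps; being finitely many, they serve as their
    own representatives.\<close>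
  let ?G = "F \<union> ({y. y islimpt Dset T} \<inter> I01)"
  have "x \<in> (\<Union>z\<in>?G. full_orbit T z)" if x: "x \<in> Dset T" for x
  proof -
    consider "x \<in> discont T" | "x islimpt Dset T" using Dset_cases x by blast
    then show ?thesis
    proof cases
      case 1
      then show ?thesis using discont_gap_level F(3) by blast
    next
      case 2
      have "x \<in> I01" using x by (simp add: Dset_def)
      moreover from this have "x \<in> full_orbit T x" unfolding full_orbit_def by blast
      ultimately show ?thesis using 2 by blast
    qed
  qed
  then have "Dset T \<subseteq> (\<Union>z\<in>?G. full_orbit T z)" by (rule subsetI)
  moreover have "finite ?G" "?G \<subseteq> I01" using F finite_limit_points by auto
  ultimately show ?thesis by blast
qed

lemma countable_Dset: "countable (Dset T)"
proof -
  have "Dset T \<subseteq> (\<Union>n. {x. gap_level n x}) \<union> {y. y islimpt Dset T}"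
    using Dset_cases discont_gap_level by blast
  moreover have "countable ((\<Union>n. {x. gap_level n x}) \<union> {y. y islimpt Dset T})"
    using gap_level_count(1) finite_limit_points by (intro countable_Un countable_UN) (auto intro: countable_finite)
  ultimately show ?thesis by (rule countable_subset)
qed

subsection \<open>The interval exchange\<close>

text \<open>These are the left ends of the intervals on which the first letter of \<open>W x\<close>
  is constant.\<close>

definition letter_starts :: "real set" where
  "letter_starts = f ` {m \<in> L. \<forall>v\<in>L. v 0 = m 0 \<longrightarrow> m \<sqsubseteq> v}"

lemma finite_letter_starts: "finite letter_starts"
proof -
  let ?M = "{m \<in> L. \<forall>v\<in>L. v 0 = m 0 \<longrightarrow> m \<sqsubseteq> v}"
  have "inj_on (\<lambda>m. m 0) ?M" by (rule inj_onI) (auto intro: lex_antisym)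
  then have "finite ?M" by (rule finite_imageD[rotated]) simp
  then show ?thesis unfolding letter_starts_def by simp
qed

lemma letter_starts_subset: "letter_starts \<subseteq> {0..1}"
  unfolding letter_starts_def using f_in_01 by blast

text \<open>If the first letter changed between \<open>x1\<close> and \<open>x2\<close>, the least
  word starting with the new letter would have its value in \<open>{x1<..x2}\<close>.\<close>

lemma same_letter:
  assumes x: "x1 \<in> {0..1}" "x2 \<in> {0..1}" "x1 \<le> x2" "{x1<..x2} \<inter> letter_starts = {}"
  shows "W x1 0 = W x2 0"
proof (rule ccontr)
  assume ne: "W x1 0 \<noteq> W x2 0"
  let ?K = "{v \<in> L. v 0 = W x2 0}"
  have "x1 \<noteq> x2" using ne by auto
  then have "W x1 0 < W x2 0"
    using ne le_first_letter[of "W x1" "W x2"] W_strict_mono[OF x(1,2)] x(3) by simp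
  have "closed ?K"
    unfolding closed_iff_agree
  proof (intro allI impI)
    fix u assume u: "\<forall>k. \<exists>v\<in>?K. agree k v u"
    then have "u \<in> L" by (intro closedD_agree[OF closed_L]) blast
    moreover obtain v where "v \<in> ?K" "agree 1 v u" using u by blast
    ultimately show "u \<in> ?K" by (simp add: agree_def)
  qed
  moreover have "W x2 \<in> ?K" using W(1)[OF x(2)] by simp
  ultimately obtain m where m: "m \<in> ?K" "\<And>v. v \<in> ?K \<Longrightarrow> m \<sqsubseteq> v"
    using closed_words_has_min[of ?K] by blast
  then have "f m \<in> letter_starts" unfolding letter_starts_def by (intro imageI) simp
  moreover have "f m \<le> x2" using f_mono[OF m(2)[OF \<open>W x2 \<in> ?K\<close>]] W(2)[OF x(2)] by simp
  moreover have "x1 < f m"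
  proof (rule ccontr)
    assume "\<not> x1 < f m"
    then have "m \<sqsubseteq> W x1" using W(3)[OF x(1), of m] m(1) by simp
    then have "m 0 \<le> W x1 0" by (rule le_first_letter)
    then show False using m(1) \<open>W x1 0 < W x2 0\<close> by simp
  qed
  ultimately show False using x(4) by auto
qed

text \<open>Deleting a common first letter preserves the strict order of words, and \<open>W\<close>
  transports it to the values because the shifted words are again of the form
  \<open>W (T x)\<close>.\<close>

lemma T_strict_mono_same_letter:
  assumes "x1 \<in> I01" "x2 \<in> I01" "x1 < x2" "W x1 0 = W x2 0" shows "T x1 < T x2"
proof (rule ccontr)
  assume "\<not> ?thesis"
  moreover have "shiftmap (W x1) \<sqsubset> shiftmap (W x2)"
    using shiftmap_less_iff[of "W x1" "W x2"] assms W_strict_mono[of x1 x2] by simp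
  then have "W (T x1) \<sqsubset> W (T x2)" using W_T assms by simp
  ultimately show False
    using W_strict_mono[of "T x2" "T x1"] T_in[OF assms(1)] T_in[OF assms(2)]
    by (cases "T x1 = T x2") (auto dest: lex.less_asym)
qed

text \<open>If \<open>a s\<close> were missing from \<open>L\<close>, its neighbours in
  \<open>L\<close> below and above would be consecutive, both starting with \<open>a\<close>. Their
  shifts have \<open>s\<close> strictly between them, so \<open>T\<close> would jump at their common
  value, which lies in \<open>{x1<..x2}\<close>.\<close>

lemma no_gap:
  assumes x: "x1 \<in> I01" "x2 \<in> I01" "x1 < x2" and letter: "W x1 0 = a" "W x2 0 = a"
    and cont: "{x1<..x2} \<inter> discont T = {}"
    and s: "s \<in> L" "shiftmap (W x1) \<sqsubseteq> s" "s \<sqsubseteq> shiftmap (W x2)"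
  shows "wcons a s \<in> L"
proof (rule ccontr)
  assume no: "wcons a s \<notin> L"
  have x01: "x1 \<in> {0..1}" "x2 \<in> {0..1}" using x by auto
  have W1: "W x1 \<sqsubseteq> wcons a s" using s(2) letter(1) by (metis lex_le_wcons wcons_shiftmap)
  have W2: "wcons a s \<sqsubseteq> W x2" using s(3) letter(2) by (metis lex_le_wcons wcons_shiftmap)
  let ?K1 = "L \<inter> {v. v \<sqsubseteq> wcons a s}" and ?K2 = "L \<inter> {v. wcons a s \<sqsubseteq> v}"
  have "closed ?K1" "closed ?K2" using closed_L closed_lex_le_left closed_lex_le_right by auto
  moreover have k1: "W x1 \<in> ?K1" and k2: "W x2 \<in> ?K2" using W(1) x01 W1 W2 by auto
  ultimately obtain m M where m: "m \<in> ?K1" "\<And>v. v \<in> ?K1 \<Longrightarrow> v \<sqsubseteq> m"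
    and M: "M \<in> ?K2" "\<And>v. v \<in> ?K2 \<Longrightarrow> M \<sqsubseteq> v"
    using closed_words_has_max[of ?K1] closed_words_has_min[of ?K2] by (metis empty_iff)
  have ms: "m \<sqsubset> wcons a s" and sM: "wcons a s \<sqsubset> M" using m(1) M(1) no by (auto simp: lex.less_le)
  then have c: "consec m M" unfolding consec_def
    using m M lex.linear by (metis IntD1 IntI lex.less_trans mem_Collect_eq)
  have W1m: "W x1 \<sqsubseteq> m" and W2M: "M \<sqsubseteq> W x2" using m(2)[OF k1] M(2)[OF k2] by auto
  have m0: "m 0 = a"
    using le_first_letter[OF W1m] le_first_letter[of m "wcons a s"] ms letter(1) by simp
  have M0: "M 0 = a"
    using le_first_letter[OF W2M] le_first_letter[of "wcons a s" M] sM letter(2) by simp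
  define x0 where "x0 = f M"
  have Wx0: "Wl x0 = m" "W x0 = M" unfolding x0_def using consec_Wl_W[OF c] by auto
  have "x0 \<le> x2" unfolding x0_def using f_mono[OF W2M] W(2)[OF x01(2)] by simp
  moreover have "x1 < x0"
  proof (rule ccontr)
    assume "\<not> x1 < x0"
    then have "M \<sqsubseteq> W x1" using W(3)[OF x01(1), of M] M(1) x0_def by simp
    then show False using W1m ms sM by (meson lex.le_less_trans lex.less_trans lex.less_irrefl)
  qed
  moreover have "x0 \<in> I01" "0 < x0" using calculation x by auto
  moreover have "f (shiftmap m) \<noteq> f (shiftmap M)"
  proof -
    have "shiftmap m \<sqsubset> s" "s \<sqsubset> shiftmap M"
      using ms sM m0 M0 by (metis lex_less_wcons wcons_shiftmap)+
    then show ?thesis using f_less_between s(1) by (metis order_less_irrefl)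
  qed
  ultimately have "x0 \<in> discont T" using discont_iff[of x0] Wx0 by simp
  then show False using cont \<open>x0 \<le> x2\<close> \<open>x1 < x0\<close> by auto
qed

text \<open>The increment of \<open>T\<close> is the measure of the word interval \<open>V\<close>,
  by invariance that of its preimage \<open>P\<close>. By \<open>no_gap\<close>, \<open>P\<close>
  exceeds the interval \<open>U\<close> only by extensions of left special words, a finite and hence
  null set.\<close>

lemma T_increment:
  assumes x: "x1 \<in> I01" "x2 \<in> I01" "x1 < x2" and letter: "W x1 0 = a" "W x2 0 = a"
    and cont: "{x1<..x2} \<inter> discont T = {}"
  shows "T x2 - T x1 = x2 - x1"
proof -
  have x01: "x1 \<in> {0..1}" "x2 \<in> {0..1}" using x by auto
  have less: "W x1 \<sqsubset> W x2" using W_strict_mono x01 x(3) by simp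
  let ?s1 = "shiftmap (W x1)" and ?s2 = "shiftmap (W x2)"
  have less': "?s1 \<sqsubset> ?s2" using less letter shiftmap_less_iff[of "W x1" "W x2"] by simp
  define U where "U = {v \<in> L. W x1 \<sqsubset> v \<and> v \<sqsubseteq> W x2}"
  define V where "V = {v \<in> L. ?s1 \<sqsubset> v \<and> v \<sqsubseteq> ?s2}"
  define P where "P = {v \<in> L. shiftmap v \<in> V}"
  have sets: "U \<in> sets \<mu>" "V \<in> sets \<mu>" "P \<in> sets \<mu>"
    unfolding P_def by (rule_tac [3] shift_preimage(1)) (simp_all add: U_def V_def)
  have UP: "U \<subseteq> P"
  proof
    fix v assume "v \<in> U"
    then have v: "v \<in> L" "W x1 \<sqsubset> v" "v \<sqsubseteq> W x2" by (auto simp: U_def)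
    have "v 0 = a" using le_first_letter[of "W x1" v] le_first_letter[of v "W x2"] v letter by simp
    then show "v \<in> P" using v letter shiftmap_less_iff[of "W x1" v] shiftmap_le_iff[of v "W x2"] shiftmap_in_L
      by (simp add: P_def V_def)
  qed
  have "P - U \<subseteq> {wcons b s | b s. s \<in> left_special}"
  proof
    fix v assume "v \<in> P - U"
    then have v: "v \<in> L" "shiftmap v \<in> L" "?s1 \<sqsubset> shiftmap v" "shiftmap v \<sqsubseteq> ?s2" "v \<notin> U"
      by (auto simp: P_def V_def)
    have "v 0 \<noteq> a"
    proof
      assume "v 0 = a"
      then have "v \<in> U" using v letter shiftmap_less_iff[of "W x1" v] shiftmap_le_iff[of v "W x2"]
        by (simp add: U_def)
      then show False using v(5) by simp
    qed
    moreover have "wcons a (shiftmap v) \<in> L"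
      using no_gap[OF x letter cont v(2)] v(3,4) by simp
    moreover have "wcons (v 0) (shiftmap v) \<in> L" using v(1) by simp
    ultimately have "shiftmap v \<in> left_special" unfolding left_special_def by blast
    then show "v \<in> {wcons b s | b s. s \<in> left_special}" by (metis (mono_tags, lifting) mem_Collect_eq wcons_shiftmap)
  qed
  then have "finite (P - U)" using finite_left_special_extensions finite_subset by blast
  then have "measure \<mu> (P - U) = 0" by (intro measure_finite_set) (auto simp: P_def)
  then have "measure \<mu> P = measure \<mu> U" using finite_measure_Diff[OF sets(3,1) UP] by simp
  moreover have "measure \<mu> P = measure \<mu> V" unfolding P_def using shift_preimage(2)[OF sets(2)] .
  moreover have "measure \<mu> U = x2 - x1"
    using f_diff[of "W x1" "W x2"] less W(2) x01 by (simp add: U_def)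
  moreover have "measure \<mu> V = T x2 - T x1"
    using f_diff[of ?s1 ?s2] less' T_eq x01 by (simp add: V_def)
  ultimately show ?thesis by simp
qed

text \<open>The function \<open>T t - t\<close> is continuous and locally constant off the finite
  set \<open>letter_starts\<close>, hence constant. A discontinuity at \<open>x\<close> itself is
  allowed, because only right continuity is used there.\<close>

lemma T_translation:
  assumes x: "0 \<le> x" "x' \<le> 1" and cont: "{x<..<x'} \<inter> discont T = {}" and t: "t \<in> {x..<x'}"
  shows "T t = t + (T x - x)"
proof -
  define g where "g t = T t - t" for t
  have tI: "y \<in> I01" if "y \<in> {x..t}" for y using that x t by auto
  have "g t = g x"
  proof (rule has_derivative_zero_unique_strong_interval[where f = g and a = x and b = t, OF finite_letter_starts])
    show "t \<in> {x..t}" using t by simp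
    show "continuous_on {x..t} g"
      unfolding continuous_on_eq_continuous_within
    proof
      fix y assume y: "y \<in> {x..t}"
      have "continuous (at y within {x..t}) T"
      proof (cases "y = x")
        case True
        then show ?thesis using T_right_continuous[OF tI[OF y]] x t
          by (auto intro: continuous_within_subset)
      next
        case False
        then have "y \<in> {x<..<x'}" using y t by auto
        then have "y \<notin> discont T" using cont by blast
        then have "continuous (at y within I01) T" using tI[OF y] by (simp add: discont_def)
        then show ?thesis using tI by (auto intro: continuous_within_subset)
      qed
      then show "continuous (at y within {x..t}) g" unfolding g_def by (intro continuous_intros)
    qed
    fix y assume y: "y \<in> {x..t} - letter_starts"
    obtain d where d: "d > 0" "\<forall>b\<in>letter_starts. b \<noteq> y \<longrightarrow> d \<le> dist y b"
      using finite_set_avoid[OF finite_letter_starts, of y] by (elim exE conjE)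
    have eq: "g u = g v" if uv: "u \<in> {x..t}" "v \<in> {x..t}" "u < v" "\<bar>u - y\<bar> < d" "\<bar>v - y\<bar> < d" for u v
    proof -
      have "{u<..v} \<inter> letter_starts = {}"
      proof (rule ccontr)
        assume "\<not> ?thesis"
        then obtain b where b: "b \<in> letter_starts" "u < b" "b \<le> v" by auto
        moreover have "b \<noteq> y" using b(1) y by auto
        ultimately have "d \<le> dist y b" using d(2) by blast
        then show False using b uv(4,5) by (simp add: dist_real_def)
      qed
      then have "W u 0 = W v 0" using same_letter[of u v] tI[OF uv(1)] tI[OF uv(2)] uv(3) by simp
      moreover have "{u<..v} \<subseteq> {x<..<x'}" using uv(1,2) t by auto
      then have "{u<..v} \<inter> discont T = {}" using cont by blast
      ultimately have "T v - T u = v - u" using T_increment[OF tI[OF uv(1)] tI[OF uv(2)] uv(3)] by simp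
      then show ?thesis by (simp add: g_def)
    qed
    have yt: "y \<in> {x..t}" using y by simp
    have "g y = g u" if u: "u \<in> {x..t}" "dist u y < d" for u
    proof (cases u y rule: linorder_cases)
      case less
      then show ?thesis using eq[OF u(1) yt] u(2) d(1) by (simp add: dist_real_def)
    next
      case greater
      then show ?thesis using eq[OF yt u(1)] u(2) d(1) by (simp add: dist_real_def)
    qed simp
    then show "(g has_derivative (\<lambda>h. 0)) (at y within {x..t})"
      by (rule has_derivative_transform_within[OF has_derivative_const d(1) yt])
  qed simp
  then show ?thesis by (simp add: g_def)
qed

text \<open>Away from \<open>D_acc_r\<close> there is no discontinuity immediately to the right of
  \<open>x\<close>, so \<open>no_gap\<close> applies: all words of \<open>L\<close> just above the
  shift of \<open>W x\<close> can be prefixed by its first letter.\<close>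

lemma right_neighbourhood_extends:
  assumes x: "x \<in> I01" "x \<notin> D_acc_r T"
  obtains u where "u \<in> L" "shiftmap (W x) \<sqsubset> u"
    "\<And>s. s \<in> L \<Longrightarrow> shiftmap (W x) \<sqsubseteq> s \<Longrightarrow> s \<sqsubseteq> u \<Longrightarrow> wcons (W x 0) s \<in> L"
proof -
  have x01: "x \<in> {0..1}" using x by simp
  have "\<not> x islimpt (Dset T \<inter> {x<..})" using x by (auto simp: D_acc_r_def)
  then obtain d where d: "d > 0" "\<And>y. y \<in> Dset T \<Longrightarrow> x < y \<Longrightarrow> d \<le> dist y x"
    unfolding islimpt_approachable by (auto simp: not_less)
  obtain v where v: "v \<in> L" "W x \<sqsubset> v" "agree 1 (W x) v" using right_limit_W[OF x(1)] unfolding right_limit_def by blast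
  have "x < f v" using W(3)[OF x01 v(1)] v(2) by (metis lex.not_le linorder_not_le)
  \<comment> \<open>The bound \<open>d\<close> keeps discontinuities out of \<open>{x<..y}\<close>,
    and \<open>f v\<close> keeps the first letter unchanged.\<close>
  define y where "y = x + min d (f v - x) / 2"
  have y: "x < y" "y < f v" "y < x + d" using d(1) \<open>x < f v\<close> by (auto simp: y_def min_def field_simps)
  have yI: "y \<in> I01" using y x(1) f_range(2)[of v] by auto
  then have y01: "y \<in> {0..1}" by simp
  have "W x \<sqsubseteq> W y" using W_strict_mono[OF x01 y01] y by simp
  moreover have "W y \<sqsubseteq> v" using W(3)[OF y01 v(1)] y by (metis lex.linear not_le)
  ultimately have "agree 1 (W x) (W y)" using v(3) by (rule agree_between)
  then have letter: "W y 0 = W x 0" by (simp add: agree_def)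
  have disc: "discont T \<subseteq> Dset T"
    unfolding Dset_def using closure_subset[of "discont T"] by (auto simp: discont_def)
  have cont: "{x<..y} \<inter> discont T = {}"
  proof (rule ccontr)
    assume "\<not> ?thesis"
    then obtain z where z: "z \<in> discont T" "x < z" "z \<le> y" by auto
    then have "d \<le> dist z x" using d(2) disc by blast
    then show False using z y by (simp add: dist_real_def)
  qed
  show thesis
  proof (rule that[of "shiftmap (W y)"])
    show "shiftmap (W y) \<in> L" using W(1)[OF y01] by (rule shiftmap_in_L)
    show "shiftmap (W x) \<sqsubset> shiftmap (W y)"
      using W_strict_mono[OF x01 y01 y(1)] letter shiftmap_less_iff[of "W x" "W y"] by simp
  qed (rule no_gap[OF x(1) yI y(1) refl letter cont])
qed

text \<open>Two points with the same image have words \<open>a s\<close> and \<open>b s\<close> with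
  different letters. Then all words of \<open>L\<close> just above \<open>s\<close> are left
  special, so they are finitely many and null. This gives \<open>s\<close> a successor, although
  \<open>s\<close> is a right limit.\<close>

lemma T_inj: "inj_on T (I01 - D_acc_r T)"
proof (rule inj_onI, rule ccontr)
  fix x1 x2 assume x: "x1 \<in> I01 - D_acc_r T" "x2 \<in> I01 - D_acc_r T" and eq: "T x1 = T x2" and ne: "x1 \<noteq> x2"
  have x01: "x1 \<in> {0..1}" "x2 \<in> {0..1}" using x by auto
  define s where "s = shiftmap (W x1)"
  have s2: "s = shiftmap (W x2)" using W_T[of x1] W_T[of x2] x eq by (simp add: s_def)
  have "W x1 \<noteq> W x2" using W(2) x01 ne by metis
  then have letters: "W x1 0 \<noteq> W x2 0" using s_def s2 by (metis wcons_shiftmap)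
  have rs: "right_limit s" unfolding s_def using right_limit_W right_limit_shiftmap x by blast
  obtain u1 where u1: "u1 \<in> L" "s \<sqsubset> u1"
      "\<And>z. z \<in> L \<Longrightarrow> s \<sqsubseteq> z \<Longrightarrow> z \<sqsubseteq> u1 \<Longrightarrow> wcons (W x1 0) z \<in> L"
    using right_neighbourhood_extends[of x1] x unfolding s_def by blast
  obtain u2 where u2: "u2 \<in> L" "s \<sqsubset> u2"
      "\<And>z. z \<in> L \<Longrightarrow> s \<sqsubseteq> z \<Longrightarrow> z \<sqsubseteq> u2 \<Longrightarrow> wcons (W x2 0) z \<in> L"
    using right_neighbourhood_extends[of x2] x unfolding s2 by blast
  obtain u where u: "u \<in> L" "s \<sqsubset> u" "u \<sqsubseteq> u1" "u \<sqsubseteq> u2"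
    using u1 u2 by (cases "u1 \<sqsubseteq> u2") auto
  have sub: "{v \<in> L. s \<sqsubset> v \<and> v \<sqsubseteq> u} \<subseteq> left_special"
  proof
    fix z assume "z \<in> {v \<in> L. s \<sqsubset> v \<and> v \<sqsubseteq> u}"
    then have z: "z \<in> L" "s \<sqsubseteq> z" "z \<sqsubseteq> u1" "z \<sqsubseteq> u2" using u(3,4) by auto
    then have "wcons (W x1 0) z \<in> L" "wcons (W x2 0) z \<in> L" using u1(3) u2(3) by auto
    then show "z \<in> left_special" unfolding left_special_def using letters by blast
  qed
  have "finite {v \<in> L. s \<sqsubset> v \<and> v \<sqsubseteq> u}" using sub finite_left_special by (rule finite_subset)
  then have "measure \<mu> {v \<in> L. s \<sqsubset> v \<and> v \<sqsubseteq> u} = 0" by (intro measure_finite_set) auto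
  then have "f s = f u" using f_diff[of s u] u(2) by simp
  then have "consec s u" using f_eq_imp_consec rs u(1,2) by (simp add: right_limit_def)
  then show False using right_limit_not_consec rs by blast
qed

lemma T_infinite_IET: assumes "infinite (discont T)" shows "infinite_IET T"
  unfolding infinite_IET_def
proof (intro conjI ballI allI impI)
  show "T x \<in> I01" if "x \<in> I01" for x using that by (rule T_in)
  show "infinite (discont T)" by (rule assms)
  show "Dset T \<in> null_sets lborel" using countable_Dset by (rule countable_imp_null_set_lborel)
  show "inj_on T (I01 - D_acc_r T)" by (rule T_inj)
  show "continuous (at x within {x..<1}) T" if "x \<in> I01" for x using that by (rule T_right_continuous)
  fix x x' assume h: "x \<in> Dset T \<and> x' \<in> Dset T \<union> {1} \<and> x < x' \<and> {x..<x'} \<inter> discont T \<subseteq> {x}"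
  then have "0 \<le> x" "x' \<le> 1" by (auto simp: Dset_def)
  moreover have "{x<..<x'} \<subseteq> {x..<x'} - {x}" by auto
  then have "{x<..<x'} \<inter> discont T = {}" using h by blast
  ultimately show "\<exists>c. \<forall>t\<in>{x..<x'}. T t = t + c" using T_translation by blast
qed

lemma T_finite_IET: assumes "finite (discont T)" shows "finite_IET T"
  unfolding finite_IET_def
proof (intro conjI ballI)
  show "T x \<in> I01" if "x \<in> I01" for x using that by (rule T_in)
  have "closure (discont T) = discont T" using assms by (simp add: finite_imp_closed)
  then have "finite (Dset T)" using assms by (simp add: Dset_def)
  \<comment> \<open>Without accumulation points the restricted injectivity of \<open>T_inj\<close>
    covers all of \<open>[0,1)\<close>.\<close>
  then have "D_acc_r T = {}" unfolding D_acc_r_def using islimpt_finite by blast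
  then show "inj_on T I01" using T_inj by simp
  have D01: "discont T \<subseteq> {0..1}" by (auto simp: discont_def)
  obtain xs :: "nat \<Rightarrow> real" and m where xs: "xs 0 = 0" "xs m = 1" "\<And>i. i < m \<Longrightarrow> xs i < xs (Suc i)"
    "\<And>i. i < m \<Longrightarrow> 0 \<le> xs i \<and> xs (Suc i) \<le> 1"
    "\<And>i. i < m \<Longrightarrow> discont T \<inter> {xs i<..<xs (Suc i)} = {}"
    using partition_sequence[OF assms D01] by blast
  have "\<exists>c. \<forall>t\<in>{xs i..<xs (Suc i)}. T t = t + c" if i: "i < m" for i
  proof -
    have "{xs i<..<xs (Suc i)} \<inter> discont T = {}" using xs(5)[OF i] by blast
    then show ?thesis using T_translation xs(4)[OF i] by blast
  qed
  then show "\<exists>xs m. xs 0 = 0 \<and> xs m = 1 \<and> (\<forall>i<m. xs i < xs (Suc i)) \<and>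
       (\<forall>i<m. \<exists>c. \<forall>t\<in>{xs i..<xs (Suc i)}. T t = t + c)"
    using xs by blast
qed

lemma T_piecewise_increasing:
  "\<exists>(xs::nat \<Rightarrow> real) m. xs 0 = 0 \<and> xs m = 1 \<and> (\<forall>i<m. xs i < xs (Suc i)) \<and>
        (\<forall>i<m. strict_mono_on {xs i..<xs (Suc i)} T)"
proof -
  obtain xs :: "nat \<Rightarrow> real" and m where xs: "xs 0 = 0" "xs m = 1" "\<And>i. i < m \<Longrightarrow> xs i < xs (Suc i)"
    "\<And>i. i < m \<Longrightarrow> 0 \<le> xs i \<and> xs (Suc i) \<le> 1"
    "\<And>i. i < m \<Longrightarrow> letter_starts \<inter> {xs i<..<xs (Suc i)} = {}"
    using partition_sequence[OF finite_letter_starts letter_starts_subset] by blast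
  have "strict_mono_on {xs i..<xs (Suc i)} T" if i: "i < m" for i
  proof (rule strict_mono_onI)
    fix r s assume rs: "r \<in> {xs i..<xs (Suc i)}" "s \<in> {xs i..<xs (Suc i)}" "r < s"
    have I: "r \<in> I01" "s \<in> I01" using rs xs(4)[OF i] by auto
    have "{r<..s} \<subseteq> {xs i<..<xs (Suc i)}" using rs by auto
    then have "{r<..s} \<inter> letter_starts = {}" using xs(5)[OF i] by blast
    then have "W r 0 = W s 0" using same_letter[of r s] I rs(3) by simp
    then show "T r < T s" using T_strict_mono_same_letter I rs(3) by blast
  qed
  then show ?thesis using xs by blast
qed

lemma T_almost_finite: "almost_finite_IET T"
  unfolding almost_finite_IET_def IET_def
  using T_finite_IET T_infinite_IET T_piecewise_increasing finite_limit_points Dset_orbits by blast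

end

theorem theorem2:
  fixes L :: "(nat \<Rightarrow> 'a::{finite, linorder, discrete_topology}) set"
    and \<mu> :: "(nat \<Rightarrow> 'a) measure"
  assumes "is_shift L" and "minimal_shift L" and "aperiodic_shift L"
    and "linear_complexity L"
    and "prob_space \<mu>" and "sets \<mu> = sets (restrict_space borel L)"
    and "shift_invariant \<mu>"
  shows "homeomorphic_map (subtopology euclidean L) (ihat_topology (Ihat L \<mu>)) (phi L \<mu>)
       \<and> phi L \<mu> ` L = Ihat L \<mu>
       \<and> (\<forall>w\<in>L. phi L \<mu> (shiftmap w) = That L \<mu> (phi L \<mu> w))
       \<and> (\<forall>x\<in>I01. That L \<mu> (iota x) = iota (T_L L \<mu> x))
       \<and> almost_finite_IET (T_L L \<mu>)"
proof -
  interpret linear_measured_shift L \<mu>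
    by (intro linear_measured_shift.intro minimal_measured_shift.intro linear_measured_shift_axioms.intro assms)
  show ?thesis
    using phi_homeomorphic phi_image That_phi That_iota T_almost_finite by auto
qed

end
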